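(* Let $1\le d<D$ be integers, let $\mathcal{X}\subseteq\mathbb{R}^D$ have non-empty interior, and let $f:\mathcal{X}\to\mathbb{R}$ be Lipschitz continuous with constant $L>0$, i.e. $|f(x)-f(y)|\le L\|x-y\|_2$ for all $x,y\in\mathcal{X}$. Let $A$ be a $D\times d$ Gaussian matrix and $\epsilon>0$. Let $x^*$ be any global minimizer of $f$ over $\mathcal{X}$ such that $B_{\epsilon/L}(x^* )\subset\mathcal{X}$. Let $p\in\mathcal{X}\setminus G_\epsilon$ be a given vector and let $r_p:=\epsilon/(L\|x^*-p\|)$. Then $$\mathbb{P}[(\mathrm{RP}\mathcal{X})\ \text{is}\ \epsilon\text{-successful}]\ \ge\ \tau(r_p,d,D).$$
   Context: Setting: $f^*:=\min_{x\in\mathcal{X}}f(x)$ (attained), where $\mathcal{X}\subseteq\mathbb{R}^D$ may be unbounded. $G_\epsilon:=\{x\in\mathcal{X}: f(x)\le f^*+\epsilon\}$. $B_r(x)$ is the closed Euclidean ball of radius $r$ centred at $x$; $\|\cdot\|$ is the Euclidean norm. A Gaussian matrix is a random matrix whose entries are independent standard normal variables. For given $p\in\mathcal{X}$, the reduced problem $(\mathrm{RP}\mathcal{X})$ is $\min_{y\in\mathbb{R}^d} f(Ay+p)$ subject to $Ay+p\in\mathcal{X}$; it is called $\epsilon$-successful if there exists $y\in\mathbb{R}^d$ with $Ay+p\in\mathcal{X}$ and $f(Ay+p)\le f^*+\epsilon$. For $0<r<1$ and integers $1\le d<D$, $$\tau(r,d,D):=\begin{cases}(D-1)\binom{\frac{D-2}{2}}{\frac{D-1}{2}}\displaystyle\int_0^{\arcsin(r)}\sin^{D-2}(x)\,dx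 & \text{if } d=1,\\[2mm] \binom{\frac{D-2}{2}}{\frac{D-d}{2}}\,r^{D-d}(1-r^2)^{\frac{d-2}{2}} & \text{if } 1<d<D,\end{cases}$$ where $\binom{i}{j}=\frac{\Gamma(i+1)}{\Gamma(j+1)\Gamma(i-j+1)}$ for real $i,j$. *)

theory Defs
  imports "HOL-Probability.Probability"
begin

text \<open>
  Binomial coefficient for real arguments. The library's \<open>gchoose\<close> does not apply, as its lower
  argument is a natural number.
\<close>

definition real_binomial :: "real \<Rightarrow> real \<Rightarrow> real" where
  "real_binomial i j = Gamma (i + 1) / (Gamma (j + 1) * Gamma (i - j + 1))"

text \<open>
  Meaningful for \<open>0 < r < 1\<close> and \<open>1 \<le> d < D\<close>. The exponents \<open>D - 2\<close> and \<open>D - d\<close> outside the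
  \<open>real\<close> coercions are natural-number subtractions, which do not truncate in this range; the
  half-integer exponent \<open>(d - 2) / 2\<close> calls for \<open>powr\<close>, whose base is positive for \<open>r < 1\<close>.
\<close>

definition tau :: "real \<Rightarrow> nat \<Rightarrow> nat \<Rightarrow> real" where
  "tau r d D =
     (if d = 1 then
        (real D - 1) * real_binomial ((real D - 2) / 2) ((real D - 1) / 2)
          * integral {0..arcsin r} (\<lambda>x. sin x ^ (D - 2))
      else
        real_binomial ((real D - 2) / 2) ((real D - real d) / 2)
          * r ^ (D - d) * (1 - r\<^sup>2) powr ((real d - 2) / 2))"

definition gaussian_matrix :: "'w measure \<Rightarrow> ('w \<Rightarrow> real ^ 'd ^ 'n) \<Rightarrow> bool" where
  "gaussian_matrix M A \<longleftrightarrow>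
     prob_space.indep_vars M (\<lambda>_. borel) (\<lambda>(i, j) \<omega>. A \<omega> $ i $ j) UNIV \<and>
     (\<forall>i j. distributed M lborel (\<lambda>\<omega>. A \<omega> $ i $ j) (\<lambda>x. ennreal (std_normal_density x)))"

text \<open>
  The objective is a total function of which only the values on \<open>X\<close> matter. The infimum is the
  minimum of \<open>f\<close> over \<open>X\<close> whenever the latter is attained.
\<close>

definition opt_value :: "('a \<Rightarrow> real) \<Rightarrow> 'a set \<Rightarrow> real" where
  "opt_value f X = (INF x\<in>X. f x)"

definition eps_minimizers :: "('a \<Rightarrow> real) \<Rightarrow> 'a set \<Rightarrow> real \<Rightarrow> 'a set" where
  "eps_minimizers f X \<epsilon> = {x \<in> X. f x \<le> opt_value f X + \<epsilon>}"

definition RPX_successful ::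
    "(real ^ 'n \<Rightarrow> real) \<Rightarrow> (real ^ 'n) set \<Rightarrow> real \<Rightarrow> real ^ 'n \<Rightarrow> real ^ 'd ^ 'n \<Rightarrow> bool" where
  "RPX_successful f X \<epsilon> p A \<longleftrightarrow>
     (\<exists>y :: real ^ 'd. A *v y + p \<in> X \<and> f (A *v y + p) \<le> opt_value f X + \<epsilon>)"

definition RPX_success_event ::
    "'w measure \<Rightarrow> (real ^ 'n \<Rightarrow> real) \<Rightarrow> (real ^ 'n) set \<Rightarrow> real \<Rightarrow> real ^ 'n
       \<Rightarrow> ('w \<Rightarrow> real ^ 'd ^ 'n) \<Rightarrow> 'w set" where
  "RPX_success_event M f X \<epsilon> p A = {\<omega> \<in> space M. RPX_successful f X \<epsilon> p (A \<omega>)}"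

text \<open>
  As \<open>X\<close> is an arbitrary set, the success event need not be measurable, and \<open>measure M\<close> is \<open>0\<close> on
  a set that is not. Hence a lower bound \<open>c\<close> on the probability of \<open>S\<close> is understood for the inner
  measure: some measurable part of \<open>S\<close> has probability at least \<open>c\<close>. The second conjunct, the usual
  reading for measurable \<open>S\<close>, follows from the first by monotonicity and is kept for readability.
\<close>

definition prob_at_least :: "'w measure \<Rightarrow> 'w set \<Rightarrow> real \<Rightarrow> bool" where
  "prob_at_least M S c \<longleftrightarrow>
     (\<exists>E\<in>sets M. E \<subseteq> S \<and> measure M E \<ge> c) \<and>
     (S \<in> sets M \<longrightarrow> measure M S \<ge> c)"

end

(*
  Write z = x_star - p.  Whenever some point of the range of A lies within r_p |z| of z, the reduced
  problem reaches the ball of radius epsilon / L about x_star, where f is epsilon-optimal.  The law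
  of A is invariant under orthogonal maps acting from the left, so the probability of this event
  does not depend on z, and z may be replaced by an independent Gaussian vector.  Conditionally on
  A, whose range almost surely has dimension d, rotation invariance of that vector turns the range
  into a coordinate subspace, and the event becomes a cone over the coordinates.  Its Gaussian
  measure is computed in polar form; it is a regularised incomplete beta integral, equal to tau for
  d = 1 and bounded below by tau for d > 1.
*)

theory Submission
  imports Defs
begin

section \<open>Rotation invariance of the standard Gaussian measure\<close>

text \<open>The range of \<open>A\<close> is a random subspace, and describing its law directly
  would call for an invariant measure on subspaces. Randomising the direction avoids this: once the
  integrals are exchanged the subspace is fixed, only its dimension matters, and what is used is the
  rotation invariance of a single Gaussian vector. Everything thus rests on the invariance of
  Lebesgue measure under orthogonal maps, applied to vectors and also to matrices, seen as one
  Euclidean space. With \<open>m = D - d\<close>, the radial variable of the cone separates and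
  leaves a constant times the integral of \<open>sin ^ (m - 1) * cos ^ (d - 1)\<close> over
  \<open>{0..arcsin r}\<close>. For \<open>d = 1\<close> the cosine disappears. For
  \<open>d > 1\<close> all cosine factors but one are bounded below by their value
  \<open>sqrt (1 - r^2)\<close> at the upper end; the rest is a derivative and integrates to
  \<open>r ^ m / m\<close>. This is the origin of the powers of \<open>r\<close> and
  \<open>1 - r^2\<close> in \<open>tau\<close>. Closeness to the range is required with a strict
  inequality, so that the favourable pairs of matrix and direction form an open set and no
  measurability question about \<open>X\<close> arises.\<close>

lemma emeasure_lborel_ball_radius:
  fixes x y :: "'a::euclidean_space"
  shows "emeasure lborel (ball x r) = emeasure lborel (ball y r)"
  by (cases "r \<ge> 0") (simp_all add: emeasure_ball ball_empty)

lemma negligible_orthogonal_image: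
  fixes f :: "'a::euclidean_space \<Rightarrow> 'a"
  assumes "orthogonal_transformation f" "negligible N"
  shows "negligible (f ` N)"
  using assms
  by (intro negligible_differentiable_image_negligible linear_imp_differentiable_on)
     (auto simp: orthogonal_transformation_linear)

text \<open>By Vitali's covering theorem an open set is, up to a negligible set, a countable
  disjoint union of balls. An orthogonal map sends each ball to a ball of the same radius, keeps the
  balls disjoint and keeps the remainder negligible.\<close>

lemma emeasure_open_orthogonal_image:
  fixes f :: "'a::euclidean_space \<Rightarrow> 'a"
  assumes f: "orthogonal_transformation f" and S: "open S"
  shows "emeasure lborel (f ` S) = emeasure lborel S"
proof -
  have inj: "inj f" and lin: "linear f"
    using f by (auto intro: orthogonal_transformation_inj orthogonal_transformation_linear)
  have fball: "f ` ball x r = ball (f x) r" for x r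
    using f by (rule image_orthogonal_transformation_ball)
  have fS: "open (f ` S)"
    using S lin f by (simp add: open_surjective_linear_image orthogonal_transformation_surj)
  \<comment> \<open>A ball is encoded as a pair of centre and radius; the covering theorem needs
    arbitrarily small members of this family around every point of \<open>S\<close>.\<close>
  define K where "K = {i::'a \<times> real. ball (fst i) (snd i) \<subseteq> S}"
  have "\<exists>i. i \<in> K \<and> x \<in> ball (fst i) (snd i) \<and> snd i < d" if "x \<in> S" "0 < d" for x d
  proof -
    obtain e where "e > 0" "ball x e \<subseteq> S"
      using S \<open>x \<in> S\<close> open_contains_ball by blast
    then show ?thesis
      using \<open>0 < d\<close> by (intro exI[of _ "(x, min e (d / 2))"]) (auto simp: K_def)
  qed
  then obtain C where C: "countable C" "C \<subseteq> K"
    and disj: "pairwise (\<lambda>i j. disjnt (ball (fst i) (snd i)) (ball (fst j) (snd j))) C"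
    and neg: "negligible (S - (\<Union>i\<in>C. ball (fst i) (snd i)))"
    by (rule Vitali_covering_theorem_balls[of S K fst snd]) blast
  define U where "U = (\<Union>i\<in>C. ball (fst i) (snd i))"
  have "U \<subseteq> S" "open U"
    using C by (auto simp: U_def K_def)
  have null: "emeasure lborel (T - V) = 0" if "negligible (T - V)" "open T" "open V" for T V :: "'a set"
  proof -
    have "T - V \<in> null_sets lebesgue" "T - V \<in> sets lborel"
      using that by (auto simp: negligible_iff_null_sets)
    then show ?thesis
      using null_sets_completion_iff by blast
  qed
  have decomp: "emeasure lborel T = emeasure lborel V"
    if "negligible (T - V)" "open T" "open V" "V \<subseteq> T" for T V :: "'a set"
  proof -
    have "emeasure lborel T = emeasure lborel (V \<union> (T - V))"
      using that by (simp add: Un_absorb1)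
    also have "\<dots> = emeasure lborel V"
      using null[OF that(1-3)] that by (intro emeasure_Un_null_set) (auto intro!: null_setsI)
    finally show ?thesis .
  qed
  have fU: "f ` U = (\<Union>i\<in>C. ball (f (fst i)) (snd i))"
    by (simp add: U_def image_UN fball)
  have "f ` S - f ` U = f ` (S - U)"
    using inj by (simp add: image_set_diff)
  then have "negligible (f ` S - f ` U)"
    using negligible_orthogonal_image[OF f neg] by (simp add: U_def)
  then have "emeasure lborel (f ` S) = emeasure lborel (f ` U)"
    using image_mono[OF \<open>U \<subseteq> S\<close>, of f] fS by (intro decomp) (auto simp: fU)
  also have "\<dots> = (\<integral>\<^sup>+i. emeasure lborel (ball (f (fst i)) (snd i)) \<partial>count_space C)"
  proof -
    have "disjoint_family_on (\<lambda>i. ball (f (fst i)) (snd i)) C"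
      using disj inj unfolding disjoint_family_on_def pairwise_def disjnt_def fball[symmetric]
      by (metis image_Int image_empty)
    then show ?thesis
      unfolding fU using C by (intro emeasure_UN_countable) auto
  qed
  also have "\<dots> = (\<integral>\<^sup>+i. emeasure lborel (ball (fst i) (snd i)) \<partial>count_space C)"
    by (intro nn_integral_cong emeasure_lborel_ball_radius)
  also have "\<dots> = emeasure lborel U"
  proof -
    have "disjoint_family_on (\<lambda>i. ball (fst i) (snd i)) C"
      using disj unfolding disjoint_family_on_def pairwise_def disjnt_def by blast
    then show ?thesis
      unfolding U_def using C by (intro emeasure_UN_countable[symmetric]) auto
  qed
  also have "\<dots> = emeasure lborel S"
    using \<open>U \<subseteq> S\<close> \<open>open U\<close> S neg by (intro decomp[symmetric]) (auto simp: U_def)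
  finally show ?thesis .
qed

lemma borel_measurable_linear_euclidean:
  fixes f :: "'a::euclidean_space \<Rightarrow> 'b::euclidean_space"
  assumes "linear f"
  shows "f \<in> borel_measurable borel"
  using assms by (intro borel_measurable_continuous_onI linear_continuous_on)
    (simp add: linear_conv_bounded_linear)

text \<open>Lebesgue measure is determined by its values on open boxes, and the preimage of a box
  under \<open>f\<close> is its image under the orthogonal map \<open>inv f\<close>. So the case of
  open sets suffices.\<close>

lemma lborel_distr_orthogonal:
  fixes f :: "'a::euclidean_space \<Rightarrow> 'a"
  assumes f: "orthogonal_transformation f"
  shows "distr lborel borel f = lborel"
proof (rule lborel_eqI[symmetric])
  have [measurable]: "f \<in> borel_measurable borel"
    using f by (intro borel_measurable_linear_euclidean orthogonal_transformation_linear)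
  have inv: "orthogonal_transformation (inv f)" "bij f"
    using f by (auto simp: orthogonal_transformation_inv orthogonal_transformation_bij)
  fix l u :: 'a
  assume lu: "\<And>b. b \<in> Basis \<Longrightarrow> l \<bullet> b \<le> u \<bullet> b"
  have "emeasure (distr lborel borel f) (box l u) = emeasure lborel (inv f ` box l u)"
    using inv by (simp add: emeasure_distr bij_vimage_eq_inv_image)
  also have "\<dots> = emeasure lborel (box l u)"
    by (intro emeasure_open_orthogonal_image inv open_box)
  finally show "emeasure (distr lborel borel f) (box l u) = (\<Prod>b\<in>Basis. (u - l) \<bullet> b)"
    using lu by (simp add: emeasure_lborel_box_eq inner_diff_left)
qed simp

text \<open>The density is written through the norm, which makes rotation invariance visible. The
  type is an arbitrary Euclidean space, so that one notion serves vectors and matrices, the latter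
  with the Frobenius norm.\<close>

definition std_gaussian :: "'a::euclidean_space measure" where
  "std_gaussian = density lborel (\<lambda>x. ennreal (exp (- (norm x)\<^sup>2 / 2) / sqrt (2 * pi) ^ DIM('a)))"

lemma sets_std_gaussian [simp, measurable_cong]: "sets std_gaussian = sets borel"
  and space_std_gaussian [simp]: "space std_gaussian = UNIV"
  by (simp_all add: std_gaussian_def)

text \<open>Links the rotation-invariant form of the density with the coordinatewise one, which is
  what independence of the entries yields.\<close>

lemma gaussian_density_prod:
  "exp (- (norm x)\<^sup>2 / 2) / sqrt (2 * pi) ^ DIM('a) = (\<Prod>b\<in>Basis. std_normal_density (x \<bullet> b))"
  for x :: "'a::euclidean_space"
proof -
  have "(norm x)\<^sup>2 = (\<Sum>b\<in>Basis. (x \<bullet> b)\<^sup>2)"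
    by (subst power2_norm_eq_inner, subst euclidean_inner) (simp add: power2_eq_square)
  then have "exp (- (norm x)\<^sup>2 / 2) = (\<Prod>b\<in>Basis. exp (- (x \<bullet> b)\<^sup>2 / 2))"
    by (simp add: exp_sum sum_divide_distrib sum_negf[symmetric] del: sum_negf)
  then show ?thesis
    by (simp add: std_normal_density_def prod_dividef prod_constant)
qed

lemma emeasure_std_gaussian_box:
  fixes l u :: "'a::euclidean_space"
  shows "emeasure std_gaussian (box l u) =
    (\<Prod>b\<in>Basis. emeasure (density lborel std_normal_density) {l \<bullet> b <..< u \<bullet> b})"
proof -
  have "emeasure std_gaussian (box l u) =
    (\<integral>\<^sup>+x. (\<Prod>b\<in>Basis. ennreal (std_normal_density (x \<bullet> b)) * indicator {l \<bullet> b <..< u \<bullet> b} (x \<bullet> b))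
      \<partial>(lborel :: 'a measure))"
    unfolding std_gaussian_def gaussian_density_prod
    by (auto simp: emeasure_density prod.distrib prod_ennreal indicator_def box_def
          intro!: nn_integral_cong prod.neutral split: if_splits)
  also have "\<dots> = (\<Prod>b\<in>Basis. \<integral>\<^sup>+x. ennreal (std_normal_density x) * indicator {l \<bullet> b <..< u \<bullet> b} x \<partial>lborel)"
    by (rule nn_integral_lborel_prod) auto
  finally show ?thesis
    by (simp add: emeasure_density)
qed

lemma measure_eqI_box:
  fixes M N :: "'a::euclidean_space measure"
  assumes "finite_measure M" "sets M = sets borel" "sets N = sets borel"
    and eq: "\<And>l u. emeasure M (box l u) = emeasure N (box l u)"
  shows "M = N"
proof (rule measure_eqI_generator_eq)
  let ?E = "range (\<lambda>(a, b). box a b::'a set)"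
  show "Int_stable ?E"
    by (auto simp: Int_stable_def box_Int_box)
  show "?E \<subseteq> Pow UNIV" "sets M = sigma_sets UNIV ?E" "sets N = sigma_sets UNIV ?E"
    by (simp_all add: borel_eq_box assms)
  let ?A = "\<lambda>n::nat. box (- (real n *\<^sub>R One)) (real n *\<^sub>R One) :: 'a set"
  show "range ?A \<subseteq> ?E" "(\<Union>i. ?A i) = UNIV"
    unfolding UN_box_eq_UNIV by auto
  show "emeasure M (?A i) \<noteq> \<infinity>" for i
    using assms(1) by (simp add: finite_measure.emeasure_finite)
  show "emeasure M X = emeasure N X" if "X \<in> ?E" for X
    using that eq by auto
qed

lemma prob_space_std_gaussian: "prob_space (std_gaussian :: 'a::euclidean_space measure)"
proof
  have "emeasure (std_gaussian :: 'a measure) UNIV =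
      (\<integral>\<^sup>+x. (\<Prod>b\<in>Basis. ennreal (std_normal_density (x \<bullet> b))) \<partial>(lborel :: 'a measure))"
    unfolding std_gaussian_def gaussian_density_prod
    by (simp add: emeasure_density prod_ennreal)
  also have "\<dots> = (\<Prod>b\<in>(Basis :: 'a set). \<integral>\<^sup>+x. ennreal (std_normal_density x) \<partial>lborel)"
    by (rule nn_integral_lborel_prod) auto
  also have "\<dots> = 1"
    by (simp add: nn_integral_eq_integral)
  finally show "emeasure (std_gaussian :: 'a measure) (space std_gaussian) = 1"
    by simp
qed

lemma std_gaussian_distr_orthogonal:
  fixes f :: "'a::euclidean_space \<Rightarrow> 'a"
  assumes f: "orthogonal_transformation f"
  shows "distr std_gaussian borel f = std_gaussian"
proof (rule measure_eqI)
  have [measurable]: "f \<in> borel_measurable borel"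
    using f by (intro borel_measurable_linear_euclidean orthogonal_transformation_linear)
  fix S assume "S \<in> sets (distr std_gaussian borel f)"
  then have [measurable]: "S \<in> sets borel" by simp
  have [measurable]: "f -` S \<in> sets borel"
    using measurable_sets[of f borel borel S] by simp
  let ?\<phi> = "\<lambda>x::'a. ennreal (exp (- (norm x)\<^sup>2 / 2) / sqrt (2 * pi) ^ DIM('a))"
  have "emeasure (distr std_gaussian borel f) S = (\<integral>\<^sup>+x. ?\<phi> x * indicator (f -` S) x \<partial>lborel)"
    unfolding std_gaussian_def
    by (subst emeasure_distr) (simp_all add: emeasure_density)
  also have "\<dots> = (\<integral>\<^sup>+x. ?\<phi> (f x) * indicator S (f x) \<partial>lborel)"
    by (simp add: orthogonal_transformation_norm[OF f] indicator_vimage)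
  also have "\<dots> = (\<integral>\<^sup>+x. ?\<phi> x * indicator S x \<partial>(distr lborel borel f))"
    by (subst nn_integral_distr) auto
  finally show "emeasure (distr std_gaussian borel f) S = emeasure std_gaussian S"
    by (simp add: lborel_distr_orthogonal[OF f] std_gaussian_def emeasure_density)
qed simp

lemma std_gaussian_null:
  assumes "S \<in> null_sets lborel"
  shows "S \<in> null_sets std_gaussian"
proof (rule null_setsI)
  have [measurable]: "S \<in> sets borel" using assms by auto
  show "emeasure std_gaussian S = 0"
    unfolding std_gaussian_def using AE_not_in[OF assms]
    by (auto simp: emeasure_density nn_integral_0_iff_AE elim!: eventually_mono)
  show "S \<in> sets std_gaussian" by simp
qed

section \<open>Lebesgue measure in radial coordinates\<close>

lemma borel_measurable_euclidean_radius [measurable]: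
  "(\<lambda>x. sqrt (\<Sum>i\<in>I. (x i)\<^sup>2)) \<in> borel_measurable (PiM I (\<lambda>_. lborel))"
  by measurable

definition sphere_area :: "nat \<Rightarrow> real" where
  "sphere_area k = real k * unit_ball_vol (real k)"

lemma sphere_area_nonneg [simp]: "sphere_area k \<ge> 0"
  by (simp add: sphere_area_def)

lemma sphere_area_pos: "k > 0 \<Longrightarrow> sphere_area k > 0"
  by (simp add: sphere_area_def)

text \<open>Meant as the image of Lebesgue measure on a space of dimension \<open>k\<close> under
  the norm; \<open>distr_PiM_lborel_radius\<close> proves that it is.\<close>

definition radial_lborel :: "nat \<Rightarrow> real measure" where
  "radial_lborel k = density lborel (\<lambda>s. ennreal (sphere_area k * s ^ (k - 1)) * indicator {0..} s)"

lemma sets_radial_lborel [simp, measurable_cong]: "sets (radial_lborel k) = sets borel"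
  by (simp add: radial_lborel_def)

lemma sigma_finite_radial_lborel: "sigma_finite_measure (radial_lborel k)"
  unfolding radial_lborel_def
  by (subst sigma_finite_measure.sigma_finite_iff_density_finite[OF sigma_finite_lborel]) (auto simp: indicator_def)

lemma nn_integral_radial_lborel:
  assumes [measurable]: "h \<in> borel_measurable borel"
  shows "(\<integral>\<^sup>+s. h s \<partial>radial_lborel k) =
    (\<integral>\<^sup>+s. ennreal (sphere_area k * s ^ (k - 1)) * indicator {0..} s * h s \<partial>lborel)"
  unfolding radial_lborel_def by (subst nn_integral_density) auto

lemma emeasure_radial_lborel:
  assumes "k > 0"
  shows "emeasure (radial_lborel k) {..a} = (if a \<le> 0 then 0 else ennreal (unit_ball_vol (real k) * a ^ k))"
proof (cases "a \<le> 0")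
  case True
  have "emeasure (radial_lborel k) {..a} = (\<integral>\<^sup>+(s::real). 0 \<partial>lborel)"
    unfolding radial_lborel_def
  proof (subst emeasure_density)
    show "(\<integral>\<^sup>+s. ennreal (sphere_area k * s ^ (k - 1)) * indicator {0..} s * indicator {..a} s \<partial>lborel) =
        (\<integral>\<^sup>+(s::real). 0 \<partial>lborel)"
    proof (rule nn_integral_cong_AE)
      show "AE s in lborel. ennreal (sphere_area k * s ^ (k - 1)) * indicator {0..} s * indicator {..a} s = 0"
        using AE_lborel_singleton[of "0::real"]
        by eventually_elim (use True in \<open>auto simp: indicator_def\<close>)
    qed
  qed auto
  with True show ?thesis by simp
next
  case False
  have "emeasure (radial_lborel k) {..a} =
      (\<integral>\<^sup>+s. ennreal (sphere_area k * s ^ (k - 1)) * indicator {0..a} s \<partial>lborel)"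
    unfolding radial_lborel_def
    by (subst emeasure_density) (auto intro!: nn_integral_cong simp: indicator_def)
  also have "\<dots> = ennreal (unit_ball_vol (real k) * a ^ k - unit_ball_vol (real k) * 0 ^ k)"
  proof (rule nn_integral_FTC_Icc)
    show "((\<lambda>s. unit_ball_vol (real k) * s ^ k) has_real_derivative sphere_area k * s ^ (k - 1)) (at s)" for s
      by (auto intro!: derivative_eq_intros simp: sphere_area_def)
  qed (use False in auto)
  finally show ?thesis
    using False assms by simp
qed

text \<open>Both measures agree on the half-lines \<open>{..a}\<close>: one side is the volume of a
  ball, the other its value by the fundamental theorem of calculus. The index set is arbitrary so
  that a block of coordinates can be treated as well as all of them.\<close>

lemma distr_PiM_lborel_radius:
  assumes "finite I" "I \<noteq> {}"
  shows "distr (PiM I (\<lambda>_. lborel)) borel (\<lambda>x. sqrt (\<Sum>i\<in>I. (x i)\<^sup>2)) = radial_lborel (card I)"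
    (is "?N = _")
proof (rule measure_eqI_generator_eq)
  interpret product_sigma_finite "\<lambda>_. lborel :: real measure" ..
  have card: "card I > 0" using assms by (simp add: card_gt_0_iff)
  have eq: "emeasure ?N {..a} = emeasure (radial_lborel (card I)) {..a}" for a
  proof (cases "a > 0")
    case True
    have "emeasure ?N {..a} = emeasure (PiM I (\<lambda>_. lborel))
        ({x. sqrt (\<Sum>i\<in>I. (x i)\<^sup>2) \<le> a} \<inter> space (PiM I (\<lambda>_. lborel)))"
      by (subst emeasure_distr) (auto simp: vimage_def)
    then show ?thesis
      using True card assms by (simp add: emeasure_radial_lborel emeasure_cball_aux)
  next
    case False
    have "emeasure ?N {..a} = emeasure (PiM I (\<lambda>_. lborel))
        ({x. sqrt (\<Sum>i\<in>I. (x i)\<^sup>2) \<le> a} \<inter> space (PiM I (\<lambda>_. lborel)))"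
      by (subst emeasure_distr) (auto simp: vimage_def)
    \<comment> \<open>For \<open>a \<le> 0\<close> the preimage contains at most the origin, a null
      set because \<open>I\<close> is nonempty.\<close>
    also have "\<dots> \<le> emeasure (PiM I (\<lambda>_. lborel)) (Pi\<^sub>E I (\<lambda>_. {0::real}))"
    proof (rule emeasure_mono)
      show "{x. sqrt (\<Sum>i\<in>I. (x i)\<^sup>2) \<le> a} \<inter> space (PiM I (\<lambda>_. lborel)) \<subseteq> Pi\<^sub>E I (\<lambda>_. {0::real})"
      proof
        fix x assume "x \<in> {x. sqrt (\<Sum>i\<in>I. (x i)\<^sup>2) \<le> a} \<inter> space (PiM I (\<lambda>_. lborel))"
        then have x: "x \<in> space (PiM I (\<lambda>_. lborel))" "sqrt (\<Sum>i\<in>I. (x i)\<^sup>2) \<le> a"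
          by auto
        then have "(\<Sum>i\<in>I. (x i)\<^sup>2) \<le> 0"
          using False by (metis not_less order.trans real_sqrt_le_0_iff)
        then have "(\<Sum>i\<in>I. (x i)\<^sup>2) = 0"
          by (intro antisym sum_nonneg) auto
        then have "\<forall>i\<in>I. x i = 0"
          using assms by (simp add: sum_nonneg_eq_0_iff)
        then show "x \<in> Pi\<^sub>E I (\<lambda>_. {0})"
          using x by (auto simp: space_PiM PiE_iff extensional_def)
      qed
    qed (rule sets_PiM_I_finite, use assms in auto)
    also have "\<dots> = 0"
      using assms card by (subst emeasure_PiM) auto
    finally show ?thesis
      using False card by (simp add: emeasure_radial_lborel)
  qed
  let ?E = "range (\<lambda>a::real. {..a})"
  show "Int_stable ?E"
    by (auto simp: Int_stable_def)
  show "?E \<subseteq> Pow UNIV" "sets ?N = sigma_sets UNIV ?E" "sets (radial_lborel (card I)) = sigma_sets UNIV ?E"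
    by (simp_all add: borel_eq_atMost)
  show "range (\<lambda>n::nat. {..real n}) \<subseteq> ?E"
    by auto
  show "(\<Union>n::nat. {..real n}) = UNIV"
    using real_arch_simple by auto
  show "emeasure ?N {..real n} \<noteq> \<infinity>" for n :: nat
    by (simp add: eq emeasure_radial_lborel[OF card])
  show "emeasure ?N X = emeasure (radial_lborel (card I)) X" if "X \<in> ?E" for X
    using that eq by auto
qed

lemma nn_integral_PiM_lborel_radius:
  assumes "finite I" "I \<noteq> {}" and [measurable]: "h \<in> borel_measurable borel"
  shows "(\<integral>\<^sup>+x. h (sqrt (\<Sum>i\<in>I. (x i)\<^sup>2)) \<partial>PiM I (\<lambda>_. lborel)) = (\<integral>\<^sup>+s. h s \<partial>radial_lborel (card I))"
  by (simp add: distr_PiM_lborel_radius[OF assms(1,2), symmetric] nn_integral_distr)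

lemma nn_integral_lborel_coordinates:
  assumes [measurable]: "h \<in> borel_measurable borel"
  shows "(\<integral>\<^sup>+x. h x \<partial>(lborel :: 'a::euclidean_space measure)) =
    (\<integral>\<^sup>+x. h (\<Sum>b\<in>Basis. x b *\<^sub>R b) \<partial>PiM Basis (\<lambda>_. lborel))"
  by (subst lborel_eq) (simp add: nn_integral_distr)

lemma nn_integral_lborel_norm:
  assumes [measurable]: "h \<in> borel_measurable borel"
  shows "(\<integral>\<^sup>+x. h (norm x) \<partial>(lborel :: 'a::euclidean_space measure)) =
    (\<integral>\<^sup>+s. h s \<partial>radial_lborel DIM('a))"
proof -
  have "norm (\<Sum>b\<in>(Basis :: 'a set). x b *\<^sub>R b) = sqrt (\<Sum>b\<in>Basis. (x b)\<^sup>2)" for x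
    by (subst norm_eq_sqrt_inner, subst euclidean_inner) (simp add: power2_eq_square)
  then show ?thesis
    by (simp add: nn_integral_lborel_coordinates nn_integral_PiM_lborel_radius)
qed

text \<open>Tonelli over the two blocks of coordinates, each block then reduced to its radius. Two
  radii are kept because the cone compares the norm of one block with that of the other.\<close>

lemma nn_integral_lborel_two_radii:
  fixes I :: "'a::euclidean_space set"
  assumes I: "I \<subseteq> Basis" "I \<noteq> {}" "Basis - I \<noteq> {}"
    and [measurable]: "h \<in> borel_measurable (borel \<Otimes>\<^sub>M borel)"
  shows "(\<integral>\<^sup>+x. h (sqrt (\<Sum>b\<in>I. (x \<bullet> b)\<^sup>2), sqrt (\<Sum>b\<in>Basis - I. (x \<bullet> b)\<^sup>2)) \<partial>lborel) =
    (\<integral>\<^sup>+s. \<integral>\<^sup>+t. h (s, t) \<partial>radial_lborel (card (Basis - I)) \<partial>radial_lborel (card I))"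
proof -
  interpret product_sigma_finite "\<lambda>_. lborel :: real measure" ..
  let ?J = "Basis - I"
  have fin: "finite I" "finite ?J" "I \<union> ?J = Basis" "I \<inter> ?J = {}"
    using I finite_subset[OF I(1)] by auto
  have [measurable]: "(\<lambda>s. \<integral>\<^sup>+t. h (s, t) \<partial>radial_lborel (card ?J)) \<in> borel_measurable borel"
    by (rule sigma_finite_measure.borel_measurable_nn_integral[OF sigma_finite_radial_lborel]) simp
  have "(\<integral>\<^sup>+x. h (sqrt (\<Sum>b\<in>I. (x \<bullet> b)\<^sup>2), sqrt (\<Sum>b\<in>?J. (x \<bullet> b)\<^sup>2)) \<partial>lborel) =
    (\<integral>\<^sup>+x. h (sqrt (\<Sum>b\<in>I. (x b)\<^sup>2), sqrt (\<Sum>b\<in>?J. (x b)\<^sup>2)) \<partial>PiM (I \<union> ?J) (\<lambda>_. lborel))"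
    unfolding fin(3) using I
    by (subst nn_integral_lborel_coordinates)
       (auto intro!: nn_integral_cong arg_cong[where f=h] arg_cong[where f=sqrt] sum.cong
          simp: inner_sum_left_Basis)
  also have "\<dots> = (\<integral>\<^sup>+x. \<integral>\<^sup>+y. h (sqrt (\<Sum>b\<in>I. (merge I ?J (x, y) b)\<^sup>2),
      sqrt (\<Sum>b\<in>?J. (merge I ?J (x, y) b)\<^sup>2)) \<partial>PiM ?J (\<lambda>_. lborel) \<partial>PiM I (\<lambda>_. lborel))"
    by (rule product_nn_integral_fold[OF fin(4,1,2)]) measurable
  also have "\<dots> = (\<integral>\<^sup>+x. \<integral>\<^sup>+y. h (sqrt (\<Sum>b\<in>I. (x b)\<^sup>2), sqrt (\<Sum>b\<in>?J. (y b)\<^sup>2))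
      \<partial>PiM ?J (\<lambda>_. lborel) \<partial>PiM I (\<lambda>_. lborel))"
    by (intro nn_integral_cong arg_cong[where f=h] arg_cong2[where f=Pair] arg_cong[where f=sqrt] sum.cong)
       (auto simp: merge_def)
  also have "\<dots> = (\<integral>\<^sup>+x. \<integral>\<^sup>+t. h (sqrt (\<Sum>b\<in>I. (x b)\<^sup>2), t)
      \<partial>radial_lborel (card ?J) \<partial>PiM I (\<lambda>_. lborel))"
    using fin I by (intro nn_integral_cong nn_integral_PiM_lborel_radius) auto
  also have "\<dots> = (\<integral>\<^sup>+s. \<integral>\<^sup>+t. h (s, t) \<partial>radial_lborel (card ?J) \<partial>radial_lborel (card I))"
    using fin I by (intro nn_integral_PiM_lborel_radius[of I "\<lambda>s. \<integral>\<^sup>+t. h (s, t) \<partial>radial_lborel (card ?J)"]) auto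
  finally show ?thesis .
qed

section \<open>The Gaussian measure of a coordinate cone\<close>

lemma borel_measurable_tan_real [measurable]: "(tan :: real \<Rightarrow> real) \<in> borel_measurable borel"
  unfolding tan_def[abs_def] by measurable

text \<open>This radial integral is never evaluated: it cancels by
  \<open>gaussian_moment_normalization\<close>.\<close>

definition gaussian_moment :: "nat \<Rightarrow> ennreal" where
  "gaussian_moment D = (\<integral>\<^sup>+u. ennreal (u ^ (D - 1) * exp (- u\<^sup>2 / 2)) * indicator {0..} (u::real) \<partial>lborel)"

lemma tan_arcsin:
  assumes "0 < r" "r < (1::real)"
  shows "tan (arcsin r) = r / sqrt (1 - r\<^sup>2)"
  using assms by (simp add: tan_def cos_arcsin)

text \<open>Solving for \<open>s\<close> gives the slope \<open>r / sqrt (1 - r^2)\<close>, which is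
  \<open>tan (arcsin r)\<close>. With \<open>s = t * tan \<theta>\<close> the cone becomes
  \<open>\<theta> < arcsin r\<close>.\<close>

lemma cone_iff_le_tan:
  fixes s t r :: real
  assumes "0 < r" "r < 1" "0 < t" "0 \<le> s"
  shows "s\<^sup>2 < r\<^sup>2 * (s\<^sup>2 + t\<^sup>2) \<longleftrightarrow> s < t * tan (arcsin r)"
proof -
  have r2: "0 < 1 - r\<^sup>2"
    using assms by (simp add: power_less_one_iff)
  have "s\<^sup>2 < r\<^sup>2 * (s\<^sup>2 + t\<^sup>2) \<longleftrightarrow> s\<^sup>2 < (t * r)\<^sup>2 / (1 - r\<^sup>2)"
    using r2 by (simp add: field_simps power_mult_distrib)
  also have "(t * r)\<^sup>2 / (1 - r\<^sup>2) = (t * tan (arcsin r))\<^sup>2"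
    using r2 assms by (simp add: tan_arcsin power_divide power_mult_distrib)
  also have "s\<^sup>2 < (t * tan (arcsin r))\<^sup>2 \<longleftrightarrow> s < t * tan (arcsin r)"
  proof
    have "t * tan (arcsin r) \<ge> 0"
      using assms r2 by (simp add: tan_arcsin)
    then show "s\<^sup>2 < (t * tan (arcsin r))\<^sup>2 \<Longrightarrow> s < t * tan (arcsin r)"
      by (rule power2_less_imp_less[rotated])
    show "s < t * tan (arcsin r) \<Longrightarrow> s\<^sup>2 < (t * tan (arcsin r))\<^sup>2"
      using assms by (intro power_strict_mono) auto
  qed
  finally show ?thesis .
qed

text \<open>Substitution \<open>t = a * u\<close>. Applied with \<open>a = cos \<theta>\<close>, it
  separates the radius from the angle.\<close>

lemma nn_integral_scaled_gaussian_moment: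
  assumes "0 < a" "D > 0"
  shows "(\<integral>\<^sup>+t. ennreal (t ^ (D - 1) * exp (- (t / a)\<^sup>2 / 2)) * indicator {0..} t \<partial>lborel) =
    ennreal (a ^ D) * gaussian_moment D"
proof -
  have "(\<integral>\<^sup>+t. ennreal (t ^ (D - 1) * exp (- (t / a)\<^sup>2 / 2)) * indicator {0..} t \<partial>lborel) =
      ennreal a * (\<integral>\<^sup>+u. ennreal ((a * u) ^ (D - 1) * exp (- (a * u / a)\<^sup>2 / 2)) * indicator {0..} (a * u) \<partial>lborel)"
    using assms by (subst nn_integral_real_affine[where c = a and t = 0]) auto
  also have "(\<integral>\<^sup>+u. ennreal ((a * u) ^ (D - 1) * exp (- (a * u / a)\<^sup>2 / 2)) * indicator {0..} (a * u) \<partial>lborel) =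
      (\<integral>\<^sup>+u. ennreal (a ^ (D - 1)) * (ennreal (u ^ (D - 1) * exp (- u\<^sup>2 / 2)) * indicator {0..} u) \<partial>lborel)"
    using assms by (intro nn_integral_cong)
      (auto simp: indicator_def ennreal_mult[symmetric] power_mult_distrib zero_le_mult_iff mult.assoc)
  also have "\<dots> = ennreal (a ^ (D - 1)) * gaussian_moment D"
    unfolding gaussian_moment_def by (rule nn_integral_cmult) simp
  also have "ennreal a * (ennreal (a ^ (D - 1)) * gaussian_moment D) = ennreal (a ^ D) * gaussian_moment D"
    using assms by (simp add: mult.assoc[symmetric] ennreal_mult[symmetric] power_eq_if[of a D])
  finally show ?thesis .
qed

text \<open>At fixed \<open>t\<close> the substitution \<open>s = t * tan \<theta>\<close> turns
  \<open>s^2 + t^2\<close> into \<open>(t / cos \<theta>)^2\<close>. Polar coordinates are thus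
  introduced one variable at a time, by one-dimensional substitutions only.\<close>

lemma nn_integral_cone_slice:
  fixes r t :: real
  assumes r: "0 < r" "r < 1" and t: "0 < t" and m: "m > 0" and d: "d > 0"
  shows "(\<integral>\<^sup>+s. ennreal (s ^ (m - 1) * t ^ (d - 1) * exp (- (s\<^sup>2 + t\<^sup>2) / 2)) *
        indicator {s. 0 \<le> s \<and> s\<^sup>2 < r\<^sup>2 * (s\<^sup>2 + t\<^sup>2)} s \<partial>lborel) =
    (\<integral>\<^sup>+\<theta>. ennreal (tan \<theta> ^ (m - 1) / (cos \<theta>)\<^sup>2) *
        ennreal (t ^ (m + d - 1) * exp (- (t / cos \<theta>)\<^sup>2 / 2)) * indicator {0..arcsin r} \<theta> \<partial>lborel)"
proof -
  let ?\<alpha> = "arcsin r"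
  define f where "f s = s ^ (m - 1) * t ^ (d - 1) * exp (- (s\<^sup>2 + t\<^sup>2) / 2)" for s
  have \<alpha>: "0 \<le> ?\<alpha>" "?\<alpha> < pi / 2"
    using r arcsin_lt_bounded[of r] arcsin_less_mono[of 0 r] by auto
  have cos: "cos \<theta> > 0" if "\<theta> \<in> {0..?\<alpha>}" for \<theta>
    using that \<alpha> by (intro cos_gt_zero_pi) auto
  have tan: "tan \<theta> \<ge> 0" if "\<theta> \<in> {0..?\<alpha>}" for \<theta>
    using that \<alpha> by (metis atLeastAtMost_iff dual_order.strict_trans1 order_le_less tan_gt_zero tan_zero)
  have "(\<integral>\<^sup>+s. ennreal (f s) * indicator {s. 0 \<le> s \<and> s\<^sup>2 < r\<^sup>2 * (s\<^sup>2 + t\<^sup>2)} s \<partial>lborel) =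
      (\<integral>\<^sup>+s. ennreal (f s) * indicator {t * tan 0..t * tan ?\<alpha>} s \<partial>lborel)"
  \<comment> \<open>The strict cone condition and the closed interval differ only at the single
    point \<open>t * tan ?\<alpha>\<close>.\<close>
  proof (rule nn_integral_cong_AE)
    show "AE s in lborel. ennreal (f s) * indicator {s. 0 \<le> s \<and> s\<^sup>2 < r\<^sup>2 * (s\<^sup>2 + t\<^sup>2)} s =
        ennreal (f s) * indicator {t * tan 0..t * tan ?\<alpha>} s"
      using AE_lborel_singleton[of "t * tan ?\<alpha>"]
      by eventually_elim (use cone_iff_le_tan[OF r t] in \<open>auto simp: indicator_def\<close>)
  qed
  also have "\<dots> = (\<integral>\<^sup>+\<theta>. ennreal (f (t * tan \<theta>)) * ennreal (t * inverse ((cos \<theta>)\<^sup>2)) * indicator {0..?\<alpha>} \<theta> \<partial>lborel)"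
  \<comment> \<open>The substitution rule wants a nondegenerate interval;
    \<open>?\<alpha> = 0\<close> contradicts \<open>0 < r\<close>.\<close>
  proof (cases "?\<alpha> = 0")
    case False
    show ?thesis
    proof (rule nn_integral_substitution_aux)
      show "(\<lambda>s. ennreal (f s)) \<in> borel_measurable borel"
        unfolding f_def by measurable
      show "((\<lambda>\<theta>. t * tan \<theta>) has_real_derivative t * inverse ((cos \<theta>)\<^sup>2)) (at \<theta>)" if "\<theta> \<in> {0..?\<alpha>}" for \<theta>
        using cos[OF that] by (auto intro!: DERIV_cmult DERIV_tan)
      show "continuous_on {0..?\<alpha>} (\<lambda>\<theta>. t * inverse ((cos \<theta>)\<^sup>2))"
        using cos by (intro continuous_intros) (metis less_irrefl zero_eq_power2)
    qed (use \<alpha> False t in auto)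
  qed (use r in \<open>simp add: arcsin_eq_iff\<close>)
  also have "\<dots> = (\<integral>\<^sup>+\<theta>. ennreal (tan \<theta> ^ (m - 1) / (cos \<theta>)\<^sup>2) *
        ennreal (t ^ (m + d - 1) * exp (- (t / cos \<theta>)\<^sup>2 / 2)) * indicator {0..?\<alpha>} \<theta> \<partial>lborel)"
  proof (intro nn_integral_cong)
    fix \<theta> :: real
    show "ennreal (f (t * tan \<theta>)) * ennreal (t * inverse ((cos \<theta>)\<^sup>2)) * indicator {0..?\<alpha>} \<theta> =
      ennreal (tan \<theta> ^ (m - 1) / (cos \<theta>)\<^sup>2) *
        ennreal (t ^ (m + d - 1) * exp (- (t / cos \<theta>)\<^sup>2 / 2)) * indicator {0..?\<alpha>} \<theta>"
    proof (cases "\<theta> \<in> {0..?\<alpha>}")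
      case True
      have 1: "(t * tan \<theta>)\<^sup>2 + t\<^sup>2 = (t / cos \<theta>)\<^sup>2"
        using cos[OF True] sin_cos_squared_add[of \<theta>]
        by (simp add: tan_def power_divide power_mult_distrib field_simps flip: distrib_left)
      have 2: "t ^ (m + d - 1) = t ^ (m - 1) * t ^ (d - 1) * t"
        using m d by (cases m; cases d) (auto simp: power_add)
      have "f (t * tan \<theta>) * (t * inverse ((cos \<theta>)\<^sup>2)) =
          (tan \<theta> ^ (m - 1) / (cos \<theta>)\<^sup>2) * (t ^ (m + d - 1) * exp (- (t / cos \<theta>)\<^sup>2 / 2))"
        unfolding f_def 1 2 by (simp add: power_mult_distrib field_simps)
      moreover have "f (t * tan \<theta>) \<ge> 0"
        using tan[OF True] t by (simp add: f_def)
      ultimately show ?thesis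
        using tan[OF True] t by (simp add: ennreal_mult[symmetric])
    qed simp
  qed
  finally show ?thesis
    unfolding f_def .
qed

text \<open>The order of integration is exchanged twice: \<open>t\<close> is moved outside so that
  \<open>s\<close> can be replaced by the angle, then the angle is moved outside so that
  \<open>t\<close> can be rescaled by \<open>cos \<theta>\<close>.\<close>

lemma nn_integral_cone:
  fixes r :: real
  assumes r: "0 < r" "r < 1" and m: "m > 0" and d: "d > 0" and c: "c \<ge> 0"
  shows "(\<integral>\<^sup>+s. \<integral>\<^sup>+t. ennreal (exp (- (s\<^sup>2 + t\<^sup>2) / 2) * c) * indicator {s. s\<^sup>2 < r\<^sup>2 * (s\<^sup>2 + t\<^sup>2)} s
      \<partial>radial_lborel d \<partial>radial_lborel m) =
    ennreal (sphere_area m * sphere_area d * c) * gaussian_moment (m + d) *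
      (\<integral>\<^sup>+\<theta>. ennreal (sin \<theta> ^ (m - 1) * cos \<theta> ^ (d - 1)) * indicator {0..arcsin r} \<theta> \<partial>lborel)"
    (is "?lhs = _")
proof -
  let ?\<alpha> = "arcsin r"
  have cos: "cos \<theta> > 0" if "\<theta> \<in> {0..?\<alpha>}" for \<theta>
    using that r arcsin_lt_bounded[of r] by (intro cos_gt_zero_pi) auto
  define k where "k = sphere_area m * sphere_area d * c"
  have k: "k \<ge> 0" using c by (simp add: k_def)
  define F where "F s t = ennreal (s ^ (m - 1) * t ^ (d - 1) * exp (- (s\<^sup>2 + t\<^sup>2) / 2)) *
        indicator {s. 0 \<le> s \<and> s\<^sup>2 < r\<^sup>2 * (s\<^sup>2 + t\<^sup>2)} s" for s t
  have F_meas [measurable]: "(\<lambda>(s, t). F s t) \<in> borel_measurable (borel \<Otimes>\<^sub>M borel)"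
    unfolding F_def by measurable
  define G where "G \<theta> t = ennreal (tan \<theta> ^ (m - 1) / (cos \<theta>)\<^sup>2) *
        ennreal (t ^ (m + d - 1) * exp (- (t / cos \<theta>)\<^sup>2 / 2)) * indicator {0..?\<alpha>} \<theta>" for \<theta> t :: real
  have G_meas [measurable]: "(\<lambda>(\<theta>, t). G \<theta> t) \<in> borel_measurable (borel \<Otimes>\<^sub>M borel)"
    unfolding G_def by measurable
  have "?lhs = (\<integral>\<^sup>+s. \<integral>\<^sup>+t. ennreal (sphere_area m * s ^ (m - 1)) * indicator {0..} s *
      (ennreal (sphere_area d * t ^ (d - 1)) * indicator {0..} t *
      (ennreal (exp (- (s\<^sup>2 + t\<^sup>2) / 2) * c) * indicator {s. s\<^sup>2 < r\<^sup>2 * (s\<^sup>2 + t\<^sup>2)} s)) \<partial>lborel \<partial>lborel)"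
    by (simp add: nn_integral_radial_lborel nn_integral_cmult)
  also have "\<dots> = (\<integral>\<^sup>+s. \<integral>\<^sup>+t. ennreal k * (F s t * indicator {0..} t) \<partial>lborel \<partial>lborel)"
    using c by (intro nn_integral_cong)
      (auto simp: F_def k_def indicator_def ennreal_mult[symmetric] ac_simps)
  also have "\<dots> = (\<integral>\<^sup>+t. \<integral>\<^sup>+s. ennreal k * (F s t * indicator {0..} t) \<partial>lborel \<partial>lborel)"
    by (rule lborel_pair.Fubini'[symmetric]) measurable
  also have "\<dots> = ennreal k * (\<integral>\<^sup>+t. (\<integral>\<^sup>+s. F s t \<partial>lborel) * indicator {0..} t \<partial>lborel)"
    by (simp add: nn_integral_cmult nn_integral_multc)
  also have "(\<integral>\<^sup>+t. (\<integral>\<^sup>+s. F s t \<partial>lborel) * indicator {0..} t \<partial>lborel) =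
      (\<integral>\<^sup>+t. (\<integral>\<^sup>+\<theta>. G \<theta> t \<partial>lborel) * indicator {0..} t \<partial>lborel)"
  \<comment> \<open>At \<open>t = 0\<close> the substitution \<open>s = t * tan \<theta>\<close>
    collapses, so this one point is discarded.\<close>
  proof (rule nn_integral_cong_AE)
    show "AE t in lborel. (\<integral>\<^sup>+s. F s t \<partial>lborel) * indicator {0..} t =
        (\<integral>\<^sup>+\<theta>. G \<theta> t \<partial>lborel) * indicator {0..} t"
      using AE_lborel_singleton[of "0::real"]
      by eventually_elim
        (use nn_integral_cone_slice[OF r _ m d] in \<open>auto simp: indicator_def F_def G_def\<close>)
  qed
  also have "\<dots> = (\<integral>\<^sup>+t. \<integral>\<^sup>+\<theta>. G \<theta> t * indicator {0..} t \<partial>lborel \<partial>lborel)"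
    by (simp add: nn_integral_multc)
  also have "\<dots> = (\<integral>\<^sup>+\<theta>. \<integral>\<^sup>+t. G \<theta> t * indicator {0..} t \<partial>lborel \<partial>lborel)"
    by (rule lborel_pair.Fubini') measurable
  also have "\<dots> = (\<integral>\<^sup>+\<theta>. gaussian_moment (m + d) *
      (ennreal (sin \<theta> ^ (m - 1) * cos \<theta> ^ (d - 1)) * indicator {0..?\<alpha>} \<theta>) \<partial>lborel)"
  proof (rule nn_integral_cong)
    fix \<theta> :: real
    show "(\<integral>\<^sup>+t. G \<theta> t * indicator {0..} t \<partial>lborel) = gaussian_moment (m + d) *
      (ennreal (sin \<theta> ^ (m - 1) * cos \<theta> ^ (d - 1)) * indicator {0..?\<alpha>} \<theta>)"
    proof (cases "\<theta> \<in> {0..?\<alpha>}")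
      case True
      have \<theta>: "cos \<theta> > 0" "sin \<theta> \<ge> 0"
        using True cos[OF True] r arcsin_lt_bounded[of r] by (auto intro!: sin_ge_zero)
      have "(\<integral>\<^sup>+t. G \<theta> t * indicator {0..} t \<partial>lborel) = (\<integral>\<^sup>+t. ennreal (tan \<theta> ^ (m - 1) / (cos \<theta>)\<^sup>2) *
          (ennreal (t ^ (m + d - 1) * exp (- (t / cos \<theta>)\<^sup>2 / 2)) * indicator {0..} t) \<partial>lborel)"
        using True by (intro nn_integral_cong) (auto simp: G_def indicator_def)
      also have "\<dots> = ennreal (tan \<theta> ^ (m - 1) / (cos \<theta>)\<^sup>2) * (ennreal (cos \<theta> ^ (m + d)) * gaussian_moment (m + d))"
        using \<theta> m by (subst nn_integral_cmult, simp, subst nn_integral_scaled_gaussian_moment) auto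
      also have "\<dots> = ennreal (tan \<theta> ^ (m - 1) / (cos \<theta>)\<^sup>2 * cos \<theta> ^ (m + d)) * gaussian_moment (m + d)"
        using \<theta> by (simp add: mult.assoc[symmetric] ennreal_mult[symmetric] tan_def)
      \<comment> \<open>The exponent is split so that \<open>m - 1\<close> cosines clear the
        denominators of the tangents and two clear the Jacobian; \<open>d - 1\<close>
        remain.\<close>
      also have "cos \<theta> ^ (m + d) = cos \<theta> ^ (m - 1) * cos \<theta> ^ (d - 1) * (cos \<theta>)\<^sup>2"
        using m d by (cases m; cases d) (auto simp: power_add power2_eq_square)
      also have "tan \<theta> ^ (m - 1) / (cos \<theta>)\<^sup>2 * (cos \<theta> ^ (m - 1) * cos \<theta> ^ (d - 1) * (cos \<theta>)\<^sup>2) =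
          sin \<theta> ^ (m - 1) * cos \<theta> ^ (d - 1)"
        using \<theta> by (simp add: tan_def power_divide)
      finally show ?thesis
        using True by (simp add: mult.commute)
    qed (simp add: G_def)
  qed
  also have "\<dots> = gaussian_moment (m + d) *
      (\<integral>\<^sup>+\<theta>. ennreal (sin \<theta> ^ (m - 1) * cos \<theta> ^ (d - 1)) * indicator {0..?\<alpha>} \<theta> \<partial>lborel)"
    by (rule nn_integral_cmult) measurable
  finally show ?thesis
    by (simp add: k_def mult.assoc)
qed

text \<open>The total mass 1 of a Gaussian vector, read in radial coordinates.\<close>

lemma gaussian_moment_normalization:
  fixes D :: nat
  defines "D \<equiv> DIM('a::euclidean_space)"
  shows "ennreal (sphere_area D / sqrt (2 * pi) ^ D) * gaussian_moment D = 1"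
proof -
  have "1 = emeasure (std_gaussian :: 'a measure) UNIV"
    using prob_space.emeasure_space_1[OF prob_space_std_gaussian[where 'a='a]] by simp
  also have "\<dots> = (\<integral>\<^sup>+x. ennreal (exp (- (norm x)\<^sup>2 / 2) / sqrt (2 * pi) ^ D) \<partial>(lborel :: 'a measure))"
    by (simp add: std_gaussian_def emeasure_density D_def)
  also have "\<dots> = (\<integral>\<^sup>+s. ennreal (exp (- s\<^sup>2 / 2) / sqrt (2 * pi) ^ D) \<partial>radial_lborel D)"
    unfolding D_def by (rule nn_integral_lborel_norm) simp
  also have "\<dots> = (\<integral>\<^sup>+s. ennreal (sphere_area D / sqrt (2 * pi) ^ D) *
      (ennreal (s ^ (D - 1) * exp (- s\<^sup>2 / 2)) * indicator {0..} s) \<partial>lborel)"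
    by (auto simp: nn_integral_radial_lborel indicator_def ennreal_mult[symmetric] field_simps
        intro!: nn_integral_cong)
  also have "\<dots> = ennreal (sphere_area D / sqrt (2 * pi) ^ D) * gaussian_moment D"
    unfolding gaussian_moment_def by (rule nn_integral_cmult) simp
  finally show ?thesis ..
qed

text \<open>The sum over \<open>I\<close> is the squared distance from \<open>x\<close> to the span
  of the other coordinates, so this is the probability that a Gaussian vector makes an angle below
  \<open>arcsin r\<close> with a coordinate subspace.\<close>

lemma emeasure_std_gaussian_cone:
  fixes I :: "'a::euclidean_space set" and r :: real
  assumes I: "I \<subseteq> Basis" "I \<noteq> {}" "I \<noteq> Basis" and r: "0 < r" "r < 1"
  defines "m \<equiv> card I" and "D \<equiv> DIM('a)"
  shows "emeasure std_gaussian {x::'a. (\<Sum>b\<in>I. (x \<bullet> b)\<^sup>2) < r\<^sup>2 * (norm x)\<^sup>2} =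
    ennreal (sphere_area m * sphere_area (D - m) / sphere_area D) *
      (\<integral>\<^sup>+\<theta>. ennreal (sin \<theta> ^ (m - 1) * cos \<theta> ^ (D - m - 1)) * indicator {0..arcsin r} \<theta> \<partial>lborel)"
proof -
  let ?J = "Basis - I"
  let ?c = "1 / sqrt (2 * pi) ^ D"
  have fin: "finite I" using finite_subset[OF I(1)] by simp
  have J: "card ?J = D - m" "?J \<noteq> {}"
    using I fin by (auto simp: m_def D_def card_Diff_subset)
  have m: "m > 0" using I fin by (simp add: m_def card_gt_0_iff)
  have "card ?J > 0" using J(2) by (simp add: card_gt_0_iff)
  then have d: "D - m > 0" by (simp add: J)
  have norm: "(norm x)\<^sup>2 = (\<Sum>b\<in>I. (x \<bullet> b)\<^sup>2) + (\<Sum>b\<in>?J. (x \<bullet> b)\<^sup>2)" for x :: 'a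
  proof -
    have "(norm x)\<^sup>2 = (\<Sum>b\<in>Basis. (x \<bullet> b)\<^sup>2)"
      by (subst power2_norm_eq_inner, subst euclidean_inner) (simp add: power2_eq_square)
    also have "\<dots> = (\<Sum>b\<in>?J. (x \<bullet> b)\<^sup>2) + (\<Sum>b\<in>I. (x \<bullet> b)\<^sup>2)"
      using I by (intro sum.subset_diff) auto
    finally show ?thesis by simp
  qed
  define h where "h = (\<lambda>(s, t). ennreal (exp (- (s\<^sup>2 + t\<^sup>2) / 2) * ?c) *
      indicator {s. s\<^sup>2 < r\<^sup>2 * (s\<^sup>2 + t\<^sup>2)} (s::real))"
  have [measurable]: "h \<in> borel_measurable (borel \<Otimes>\<^sub>M borel)"
    unfolding h_def by measurable
  have "emeasure std_gaussian {x::'a. (\<Sum>b\<in>I. (x \<bullet> b)\<^sup>2) < r\<^sup>2 * (norm x)\<^sup>2} =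
    (\<integral>\<^sup>+x. ennreal (exp (- (norm x)\<^sup>2 / 2) / sqrt (2 * pi) ^ D) *
       indicator {x. (\<Sum>b\<in>I. (x \<bullet> b)\<^sup>2) < r\<^sup>2 * (norm x)\<^sup>2} x \<partial>(lborel :: 'a measure))"
    unfolding std_gaussian_def D_def by (subst emeasure_density) auto
  also have "\<dots> = (\<integral>\<^sup>+x. h (sqrt (\<Sum>b\<in>I. (x \<bullet> b)\<^sup>2), sqrt (\<Sum>b\<in>?J. (x \<bullet> b)\<^sup>2)) \<partial>lborel)"
    by (intro nn_integral_cong) (auto simp: h_def norm indicator_def sum_nonneg)
  also have "\<dots> = (\<integral>\<^sup>+s. \<integral>\<^sup>+t. h (s, t) \<partial>radial_lborel (D - m) \<partial>radial_lborel m)"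
    using I J by (subst nn_integral_lborel_two_radii) (auto simp: m_def)
  also have "\<dots> = ennreal (sphere_area m * sphere_area (D - m) * ?c) * gaussian_moment D *
      (\<integral>\<^sup>+\<theta>. ennreal (sin \<theta> ^ (m - 1) * cos \<theta> ^ (D - m - 1)) * indicator {0..arcsin r} \<theta> \<partial>lborel)"
    using nn_integral_cone[OF r m d, of ?c] d by (simp add: h_def)
  \<comment> \<open>\<open>sphere_area D\<close> is inserted to isolate the normalised moment, which
    equals 1.\<close>
  also have "ennreal (sphere_area m * sphere_area (D - m) * ?c) * gaussian_moment D =
      ennreal (sphere_area m * sphere_area (D - m) / sphere_area D) *
        (ennreal (sphere_area D / sqrt (2 * pi) ^ D) * gaussian_moment D)"
    using sphere_area_pos[of D] m d by (simp add: mult.assoc[symmetric] ennreal_mult[symmetric])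
  also have "ennreal (sphere_area D / sqrt (2 * pi) ^ D) * gaussian_moment D = 1"
    unfolding D_def by (rule gaussian_moment_normalization)
  finally show ?thesis by simp
qed

section \<open>Comparison of the angular integral with \<open>tau\<close>\<close>

lemma sphere_area_eq:
  assumes "k > 0"
  shows "sphere_area k = 2 * pi powr (real k / 2) / Gamma (real k / 2)"
proof -
  have G: "Gamma (real k / 2 + 1) = real k / 2 * Gamma (real k / 2)"
    using assms by (intro Gamma_plus1) auto
  have "Gamma (real k / 2) > 0"
    using assms by (intro Gamma_real_pos) auto
  then show ?thesis
    unfolding sphere_area_def unit_ball_vol_def G using assms by (simp add: field_simps)
qed

text \<open>The powers of \<open>pi\<close> cancel. What is left is 2 divided by the Beta function
  at \<open>m / 2\<close> and \<open>d / 2\<close>, the normalisation of the angular integral over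
  the whole quarter circle.\<close>

lemma sphere_area_ratio:
  assumes "m > 0" "d > 0"
  shows "sphere_area m * sphere_area d / sphere_area (m + d) =
    2 * Gamma ((real m + real d) / 2) / (Gamma (real m / 2) * Gamma (real d / 2))"
proof -
  have "pi powr (real m / 2) * pi powr (real d / 2) = pi powr ((real m + real d) / 2)"
    by (simp add: powr_add[symmetric] add_divide_distrib)
  then show ?thesis
    using assms by (simp add: sphere_area_eq field_simps)
qed

lemma nn_integral_sin_power_cos:
  assumes "0 < r" "r < (1::real)" "m > 0"
  shows "(\<integral>\<^sup>+\<theta>. ennreal (sin \<theta> ^ (m - 1) * cos \<theta>) * indicator {0..arcsin r} \<theta> \<partial>lborel) =
    ennreal (r ^ m / real m)"
proof -
  have \<alpha>: "0 \<le> arcsin r" "arcsin r < pi / 2"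
    using assms arcsin_lt_bounded[of r] by (auto intro!: arcsin_nonneg)
  have "(\<integral>\<^sup>+\<theta>. ennreal (sin \<theta> ^ (m - 1) * cos \<theta>) * indicator {0..arcsin r} \<theta> \<partial>lborel) =
      ennreal (sin (arcsin r) ^ m / real m - sin 0 ^ m / real m)"
  proof (rule nn_integral_FTC_Icc)
    show "((\<lambda>\<theta>. sin \<theta> ^ m / real m) has_real_derivative sin \<theta> ^ (m - 1) * cos \<theta>) (at \<theta>)" for \<theta>
      using assms by (auto intro!: derivative_eq_intros)
    show "0 \<le> sin \<theta> ^ (m - 1) * cos \<theta>" if "\<theta> \<in> {0..arcsin r}" for \<theta>
      using that \<alpha> by (intro mult_nonneg_nonneg zero_le_power sin_ge_zero cos_ge_zero) auto
  qed (use \<alpha> in auto)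
  with assms show ?thesis by (simp add: power_0_left)
qed

text \<open>Equality when \<open>d = 1\<close>. Otherwise \<open>cos ^ (d - 2)\<close> is replaced
  by its least value on the interval, attained at \<open>arcsin r\<close>, and the remaining
  integrand is the derivative of \<open>sin ^ m / m\<close>.\<close>

lemma tau_le_cone:
  assumes r: "0 < r" "r < 1" and m: "m > 0" and d: "d > 0"
  shows "ennreal (tau r d (m + d)) \<le> ennreal (sphere_area m * sphere_area d / sphere_area (m + d)) *
      (\<integral>\<^sup>+\<theta>. ennreal (sin \<theta> ^ (m - 1) * cos \<theta> ^ (d - 1)) * indicator {0..arcsin r} \<theta> \<partial>lborel)"
proof -
  let ?c = "sphere_area m * sphere_area d / sphere_area (m + d)"
  let ?\<alpha> = "arcsin r"
  have \<alpha>: "0 \<le> ?\<alpha>" "?\<alpha> < pi / 2"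
    using r arcsin_lt_bounded[of r] by (auto intro!: arcsin_nonneg)
  have Gm: "Gamma (real m / 2 + 1) = real m / 2 * Gamma (real m / 2)"
    using m by (intro Gamma_plus1) auto
  have Gm_pos: "Gamma (real m / 2) > 0"
    using m by (intro Gamma_real_pos) auto
  \<comment> \<open>The binomial coefficient in \<open>tau\<close> is the constant \<open>?c\<close>
    divided by \<open>m\<close>. That \<open>1 / m\<close> is the one produced by integrating
    \<open>sin ^ (m - 1) * cos\<close>; for \<open>d = 1\<close> it is cancelled by the factor
    \<open>D - 1 = m\<close>.\<close>
  have binom: "real_binomial ((real (m + d) - 2) / 2) (real m / 2) = ?c / real m"
  proof -
    have 1: "(real (m + d) - 2) / 2 + 1 = (real m + real d) / 2" by (simp add: field_simps)
    have 2: "(real (m + d) - 2) / 2 - real m / 2 + 1 = real d / 2" by (simp add: field_simps)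
    show ?thesis
      unfolding real_binomial_def 1 2 sphere_area_ratio[OF m d] Gm using m by (simp add: field_simps)
  qed
  show ?thesis
  proof (cases "d = 1")
    case True
    have int: "(\<lambda>\<theta>. sin \<theta> ^ (m - 1)) integrable_on {0..?\<alpha>}"
      by (intro integrable_continuous_interval continuous_intros)
    have nonneg: "sin \<theta> ^ (m - 1) \<ge> 0" if "\<theta> \<in> {0..?\<alpha>}" for \<theta> :: real
      using that \<alpha> by (intro zero_le_power sin_ge_zero) auto
    have "(\<integral>\<^sup>+\<theta>. ennreal (sin \<theta> ^ (m - 1)) * indicator {0..?\<alpha>} \<theta> \<partial>lborel) =
        ennreal (integral {0..?\<alpha>} (\<lambda>\<theta>. sin \<theta> ^ (m - 1)))"
      using int nonneg by (intro nn_integral_has_integral_lebesgue' integrable_integral)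
    moreover
    have "tau r d (m + d) = ?c * integral {0..?\<alpha>} (\<lambda>\<theta>. sin \<theta> ^ (m - 1))"
      using binom True m by (simp add: tau_def)
    moreover have "ennreal (?c * I) = ennreal ?c * ennreal I" for I
      by (intro ennreal_mult') simp
    ultimately show ?thesis
      using True by simp
  next
    case False
    then have d2: "d \<ge> 2" using d by simp
    define w where "w = (1 - r\<^sup>2) powr ((real d - 2) / 2)"
    have r2: "0 < 1 - r\<^sup>2" using r by (simp add: power_less_one_iff)
    \<comment> \<open>Rewritten as a natural power, so that monotonicity of powers applies;
      \<open>d - 2\<close> does not truncate here.\<close>
    have w: "w = sqrt (1 - r\<^sup>2) ^ (d - 2)"
      using r2 d2 by (simp add: w_def powr_half_sqrt[symmetric] powr_powr powr_realpow[symmetric] of_nat_diff)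
    have "ennreal w * ennreal (r ^ m / real m) =
        (\<integral>\<^sup>+\<theta>. ennreal w * (ennreal (sin \<theta> ^ (m - 1) * cos \<theta>) * indicator {0..?\<alpha>} \<theta>) \<partial>lborel)"
      using nn_integral_sin_power_cos[OF r m] by (subst nn_integral_cmult) auto
    also have "\<dots> \<le> (\<integral>\<^sup>+\<theta>. ennreal (sin \<theta> ^ (m - 1) * cos \<theta> ^ (d - 1)) * indicator {0..?\<alpha>} \<theta> \<partial>lborel)"
    proof (intro nn_integral_mono)
      fix \<theta> :: real
      show "ennreal w * (ennreal (sin \<theta> ^ (m - 1) * cos \<theta>) * indicator {0..?\<alpha>} \<theta>) \<le>
        ennreal (sin \<theta> ^ (m - 1) * cos \<theta> ^ (d - 1)) * indicator {0..?\<alpha>} \<theta>"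
      proof (cases "\<theta> \<in> {0..?\<alpha>}")
        case True
        have "cos ?\<alpha> \<le> cos \<theta>"
          using True \<alpha> by (intro cos_monotone_0_pi_le) auto
        then have "sqrt (1 - r\<^sup>2) \<le> cos \<theta>"
          using r by (simp add: cos_arcsin)
        then have "w \<le> cos \<theta> ^ (d - 2)"
          unfolding w using r2 by (intro power_mono) auto
        moreover have "0 \<le> sin \<theta>" "0 \<le> cos \<theta>"
          using True \<alpha> by (auto intro!: sin_ge_zero cos_ge_zero)
        ultimately have "w * (sin \<theta> ^ (m - 1) * cos \<theta>) \<le> cos \<theta> ^ (d - 2) * (sin \<theta> ^ (m - 1) * cos \<theta>)"
          by (intro mult_right_mono) auto
        also have "\<dots> = sin \<theta> ^ (m - 1) * cos \<theta> ^ (d - 1)"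
          using d2 power_Suc[of "cos \<theta>" "d - 2"] by (simp add: Suc_diff_Suc numeral_2_eq_2 mult_ac)
        finally show ?thesis
          using True by (simp add: ennreal_mult'[symmetric] w_def ennreal_leI)
      qed simp
    qed
    also have "ennreal w * ennreal (r ^ m / real m) = ennreal (w * (r ^ m / real m))"
      using r by (intro ennreal_mult[symmetric]) (auto simp: w_def)
    finally have "ennreal ?c * ennreal (w * (r ^ m / real m)) \<le> ennreal ?c *
        (\<integral>\<^sup>+\<theta>. ennreal (sin \<theta> ^ (m - 1) * cos \<theta> ^ (d - 1)) * indicator {0..?\<alpha>} \<theta> \<partial>lborel)"
      by (rule mult_left_mono) simp
    moreover have "tau r d (m + d) = ?c * (w * (r ^ m / real m))"
      using binom False by (simp add: tau_def w_def)
    moreover have "ennreal (?c * x) = ennreal ?c * ennreal x" for x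
      by (intro ennreal_mult') simp
    ultimately show ?thesis
      by (simp only:)
  qed
qed

section \<open>The law of a Gaussian matrix\<close>

lemma Basis_matrix_bij_betw:
  "bij_betw (\<lambda>(i, j). axis i (axis j 1)) UNIV (Basis :: (real ^ 'd ^ 'n) set)"
  by (auto simp: bij_betw_def inj_on_def axis_eq_axis Basis_vec_def)

lemma gaussian_matrix_measurable:
  assumes "gaussian_matrix M A"
  shows "A \<in> borel_measurable M"
proof -
  have "(\<lambda>\<omega>. A \<omega> $ i $ j) \<in> borel_measurable M" for i j
    using assms by (auto simp: gaussian_matrix_def distributed_def)
  then show ?thesis
    by (subst borel_measurable_euclidean_space) (auto simp: Basis_vec_def inner_axis)
qed

text \<open>On open boxes independence gives a product of one-dimensional normal probabilities,
  which is also the value of \<open>std_gaussian\<close>; boxes determine a finite measure.\<close>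

lemma gaussian_matrix_distr:
  fixes A :: "'w \<Rightarrow> real ^ 'd ^ 'n"
  assumes "prob_space M" and A: "gaussian_matrix M A"
  shows "distr M borel A = std_gaussian"
proof (rule measure_eqI_box)
  interpret prob_space M by fact
  note [measurable] = gaussian_matrix_measurable[OF A]
  show "finite_measure (distr M borel A)"
    by (intro prob_space.finite_measure prob_space_distr) measurable
  fix l u :: "real ^ 'd ^ 'n"
  let ?I = "\<lambda>(i, j). {l $ i $ j <..< u $ i $ j}"
  have indep: "indep_vars (\<lambda>_. borel) (\<lambda>(i, j) \<omega>. A \<omega> $ i $ j) UNIV"
    and distr: "\<And>i j. distributed M lborel (\<lambda>\<omega>. A \<omega> $ i $ j) (\<lambda>x. ennreal (std_normal_density x))"
    using A by (auto simp: gaussian_matrix_def)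
  have box: "B \<in> box l u \<longleftrightarrow> (\<forall>i j. B $ i $ j \<in> ?I (i, j))" for B
    by (auto simp: box_def Basis_vec_def inner_axis)
  have "emeasure (distr M borel A) (box l u) =
      emeasure M (\<Inter>k\<in>UNIV. (\<lambda>(i, j) \<omega>. A \<omega> $ i $ j) k -` ?I k \<inter> space M)"
    by (subst emeasure_distr) (auto simp: box intro!: arg_cong[where f = "emeasure M"])
  also have "\<dots> = (\<Prod>k\<in>UNIV. emeasure M ((\<lambda>(i, j) \<omega>. A \<omega> $ i $ j) k -` ?I k \<inter> space M))"
    using indep_varsD_finite[OF indep, of ?I] by (simp add: emeasure_eq_measure prod_ennreal split_beta)
  also have "\<dots> = (\<Prod>(i, j)\<in>UNIV. emeasure (density lborel std_normal_density) {l $ i $ j <..< u $ i $ j})"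
  proof (intro prod.cong refl, clarify)
    fix i j
    have "(\<lambda>\<omega>. A \<omega> $ i $ j) \<in> borel_measurable M"
      using distr[of i j] by (auto simp: distributed_def)
    moreover have "distr M borel (\<lambda>\<omega>. A \<omega> $ i $ j) = distr M lborel (\<lambda>\<omega>. A \<omega> $ i $ j)"
      by (rule distr_cong) simp_all
    ultimately show "emeasure M ((\<lambda>\<omega>. A \<omega> $ i $ j) -` {l $ i $ j <..< u $ i $ j} \<inter> space M) =
        emeasure (density lborel std_normal_density) {l $ i $ j <..< u $ i $ j}"
      using distr[of i j] by (simp add: distributed_def emeasure_distr[symmetric])
  qed
  also have "\<dots> = (\<Prod>b\<in>Basis. emeasure (density lborel std_normal_density) {l \<bullet> b <..< u \<bullet> b})"
    by (subst prod.reindex_bij_betw[OF Basis_matrix_bij_betw, symmetric])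
       (auto intro!: prod.cong simp: inner_axis)
  finally show "emeasure (distr M borel A) (box l u) = emeasure std_gaussian (box l u)"
    by (simp add: emeasure_std_gaussian_box)
qed simp_all

section \<open>Almost sure injectivity of a Gaussian matrix\<close>

lemma emeasure_lborel_translate:
  assumes [measurable]: "N \<in> sets borel"
  shows "emeasure lborel {x::'a::euclidean_space. x + c \<in> N} = emeasure lborel N"
proof -
  have "emeasure lborel N = emeasure (distr lborel borel ((+) c)) N"
    by (simp add: lborel_distr_plus)
  also have "\<dots> = emeasure lborel {x. x + c \<in> N}"
    by (subst emeasure_distr) (auto simp: vimage_def add.commute)
  finally show ?thesis ..
qed

text \<open>
  Let \<open>N j\<close> be the matrices whose column \<open>j\<close> lies in the span of the others, written in a form that
  is evidently Borel. Translating column \<open>j\<close> by a Gaussian vector does not change the Lebesgue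
  measure of \<open>N j\<close>, but for a fixed matrix the translation lands in \<open>N j\<close> only if the vector lies in
  the range of the matrix, a proper subspace.
\<close>

lemma AE_std_gaussian_injective:
  assumes dn: "CARD('d) < CARD('n)"
  shows "AE B in (std_gaussian :: (real ^ 'd ^ 'n) measure). inj ((*v) B)"
proof -
  \<comment> \<open>With the coefficient of column \<open>j\<close> normalised to 1, membership says
    that \<open>B *v y\<close> comes arbitrarily close to 0. Each union is open and the intersection
    is countable, hence the set is Borel.\<close>
  define N :: "'d \<Rightarrow> (real ^ 'd ^ 'n) set" where
    "N j = (\<Inter>n::nat. \<Union>y\<in>{y. y $ j = 1}. {B. norm (B *v y) < inverse (Suc n)})" for j
  have "open {B :: real ^ 'd ^ 'n. norm (B *v y) < e}" for y e
    by (intro open_Collect_less continuous_intros linear_continuous_on)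
       (auto simp: linear_conv_bounded_linear[symmetric] intro!: linearI
         simp: matrix_vector_mult_add_rdistrib scaleR_matrix_vector_assoc)
  then have "open (\<Union>y\<in>{y. y $ j = 1}. {B :: real ^ 'd ^ 'n. norm (B *v y) < e})" for j e
    by (intro open_UN) simp
  then have N_borel [measurable]: "N j \<in> sets borel" for j
    unfolding N_def by (intro sets.countable_INT) (auto intro: borel_open simp del: of_nat_Suc)
  have null: "N j \<in> null_sets lborel" for j
  proof -
    define E where "E v = (\<chi> i k. if k = j then v $ i else 0)" for v :: "real ^ 'n"
    have E: "(B + E v) *v y = B *v y + y $ j *\<^sub>R v" for B v y
    proof -
      have "E v *v y = y $ j *\<^sub>R v"
        by (simp add: E_def matrix_vector_mult_def vec_eq_iff if_distrib[of "\<lambda>x. x * _"] cong: if_cong)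
      then show ?thesis
        by (simp add: matrix_vector_mult_add_rdistrib)
    qed
    have linE: "linear E"
      by (intro linearI) (vector E_def)+
    have [measurable]: "E \<in> borel_measurable borel"
      using linE by (rule borel_measurable_linear_euclidean)
    interpret nu: prob_space "std_gaussian :: (real ^ 'n) measure"
      by (rule prob_space_std_gaussian)
    interpret pair_sigma_finite "std_gaussian :: (real ^ 'n) measure" "lborel :: (real ^ 'd ^ 'n) measure" ..
    \<comment> \<open>Averaging a constant over \<open>v\<close> changes nothing, because the
      Gaussian law of \<open>v\<close> has mass 1.\<close>
    have "emeasure lborel (N j) = (\<integral>\<^sup>+v. emeasure lborel (N j) \<partial>(std_gaussian :: (real ^ 'n) measure))"
      using nu.emeasure_space_1 by simp
    also have "\<dots> = (\<integral>\<^sup>+v. \<integral>\<^sup>+B. indicator (N j) (B + E v) \<partial>lborel \<partial>std_gaussian)"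
    proof (intro nn_integral_cong)
      fix v
      have "emeasure lborel (N j) = emeasure lborel {B. B + E v \<in> N j}"
        by (simp add: emeasure_lborel_translate)
      also have "\<dots> = (\<integral>\<^sup>+B. indicator {B. B + E v \<in> N j} B \<partial>lborel)"
        by (intro nn_integral_indicator[symmetric]) measurable
      finally show "emeasure lborel (N j) = (\<integral>\<^sup>+B. indicator (N j) (B + E v) \<partial>lborel)"
        by (simp add: indicator_def)
    qed
    also have "\<dots> = (\<integral>\<^sup>+B. \<integral>\<^sup>+v. indicator (N j) (B + E v) \<partial>std_gaussian \<partial>lborel)"
      by (rule Fubini'[symmetric]) measurable
    also have "\<dots> = (\<integral>\<^sup>+(B :: real ^ 'd ^ 'n). 0 \<partial>lborel)"
    proof (intro nn_integral_cong)
      fix B :: "real ^ 'd ^ 'n"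
      let ?V = "range ((*v) B)"
      have "dim ?V \<le> CARD('d)"
        using dim_image_le[of "(*v) B" UNIV] by simp
      then have "negligible ?V"
        using dn by (intro negligible_lowdim) simp
      moreover have "closed ?V"
        by (intro closed_subspace linear_subspace_image) auto
      ultimately have V: "?V \<in> null_sets std_gaussian"
        by (intro std_gaussian_null) (metis negligible_iff_null_sets null_sets_completion_iff borel_closed sets_lborel)
      have "v \<in> ?V" if "B + E v \<in> N j" for v
      proof -
        have "\<exists>w\<in>?V. dist w v < e" if "e > 0" for e
        proof -
          obtain n :: nat where n: "inverse (Suc n) < e"
            using \<open>e > 0\<close> reals_Archimedean by blast
          obtain y where "y $ j = 1" "norm ((B + E v) *v y) < inverse (Suc n)"
            using \<open>B + E v \<in> N j\<close> by (auto simp: N_def)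
          \<comment> \<open>Since \<open>(B + E v) *v y\<close> is \<open>B *v y + v\<close>, its
            smallness says that the point \<open>B *v (- y)\<close> of the range is close to
            \<open>v\<close>.\<close>
          moreover have "B *v (- y) - v = - (B *v y + v)"
            by (simp add: linear_neg[OF matrix_vector_mul_linear])
          ultimately have "dist (B *v (- y)) v < e"
            using n by (simp only: E dist_norm norm_minus_cancel scaleR_one)
          then show ?thesis by blast
        qed
        then show ?thesis
          using \<open>closed ?V\<close> closure_approachable[of v ?V] by simp
      qed
      then have "(\<integral>\<^sup>+v. indicator (N j) (B + E v) \<partial>std_gaussian) \<le> (\<integral>\<^sup>+v. indicator ?V v \<partial>std_gaussian)"
        by (intro nn_integral_mono) (auto simp: indicator_def)
      also have "\<dots> = 0"
        using V by (subst nn_integral_indicator) auto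
      finally show "(\<integral>\<^sup>+v. indicator (N j) (B + E v) \<partial>std_gaussian) = (0 :: ennreal)"
        by simp
    qed
    finally show ?thesis
      by (simp add: null_sets_def)
  qed
  have "AE B in std_gaussian. \<forall>j. B \<notin> N j"
    using std_gaussian_null[OF null] by (subst AE_all_countable) (auto intro: AE_not_in)
  then show ?thesis
  proof eventually_elim
    fix B :: "real ^ 'd ^ 'n"
    assume B: "\<forall>j. B \<notin> N j"
    have "y = 0" if "B *v y = 0" for y
    proof (rule ccontr)
      assume "y \<noteq> 0"
      then obtain j where "y $ j \<noteq> 0" by (auto simp: vec_eq_iff)
      \<comment> \<open>A kernel vector, rescaled to have \<open>j\<close>-th coordinate 1,
        witnesses membership in \<open>N j\<close>.\<close>
      then have "(inverse (y $ j) *\<^sub>R y) $ j = 1" "B *v (inverse (y $ j) *\<^sub>R y) = 0"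
        using that by (auto simp: matrix_vector_mult_scaleR)
      then have "\<exists>z. z $ j = 1 \<and> norm (B *v z) < inverse (real (Suc n))" for n
        by (intro exI[of _ "inverse (y $ j) *\<^sub>R y"]) (simp del: of_nat_Suc)
      then have "B \<in> N j"
        unfolding N_def by (simp del: of_nat_Suc)
      with B show False by simp
    qed
    then show "inj ((*v) B)"
      by (simp add: linear_injective_0)
  qed
qed

section \<open>Orthogonal maps\<close>

lemma matrix_inner_columns: "B \<bullet> C = (\<Sum>j\<in>UNIV. column j B \<bullet> column j C)"
  for B C :: "real ^ 'd ^ 'n"
  unfolding inner_vec_def column_def by (simp add: sum.swap[of _ "UNIV :: 'd set"])

lemma column_matrix_mult: "column j (Q ** B) = Q *v column j B"
  by (vector column_def matrix_matrix_mult_def matrix_vector_mult_def)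

text \<open>Left multiplication acts on each column separately, and the inner product of matrices is
  the sum of those of their columns. This transfers rotation invariance to the law of a Gaussian
  matrix.\<close>

lemma orthogonal_transformation_matrix_mult:
  fixes f :: "real ^ 'n \<Rightarrow> real ^ 'n"
  assumes "orthogonal_transformation f"
  shows "orthogonal_transformation (\<lambda>B :: real ^ 'd ^ 'n. matrix f ** B)"
proof -
  have "matrix f *v x = f x" for x
    using matrix_vector_mul(2)[OF orthogonal_transformation_linear[OF assms]] by (rule fun_cong)
  then have "(matrix f ** B) \<bullet> (matrix f ** C) = B \<bullet> C" for B C :: "real ^ 'd ^ 'n"
    using assms by (simp add: matrix_inner_columns column_matrix_mult orthogonal_transformation_def)
  moreover have "linear (\<lambda>B :: real ^ 'd ^ 'n. matrix f ** B)"
    by (intro linearI) (simp_all add: matrix_add_ldistrib matrix_scalar_ac scalar_matrix_assoc)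
  ultimately show ?thesis
    by (simp add: orthogonal_transformation_def)
qed

text \<open>The map sends \<open>J\<close> to an orthonormal basis of \<open>V\<close> and the other
  basis vectors to one of the orthogonal complement; the cardinalities match because the two
  dimensions add up to that of the space.\<close>

lemma orthogonal_transformation_onto_subspace:
  fixes V J :: "'a::euclidean_space set"
  assumes V: "subspace V" and J: "J \<subseteq> Basis" "card J = dim V"
  obtains f where "orthogonal_transformation f" "f ` J \<subseteq> V"
proof -
  obtain S where S: "S \<subseteq> V" "pairwise orthogonal S" "\<And>x. x \<in> S \<Longrightarrow> norm x = 1"
      "independent S" "card S = dim V"
    by (rule orthonormal_basis_subspace[OF V]) blast
  let ?W = "{y. \<forall>x\<in>V. orthogonal x y}"
  have W: "subspace ?W" by (simp add: subspace_orthogonal_to_vectors)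
  obtain T where T: "T \<subseteq> ?W" "pairwise orthogonal T" "\<And>x. x \<in> T \<Longrightarrow> norm x = 1"
      "independent T" "card T = dim ?W"
    by (rule orthonormal_basis_subspace[OF W]) blast
  have dimW: "dim ?W + dim V = DIM('a)"
    using dim_subspace_orthogonal_to_vectors[OF V subspace_UNIV] by (simp add: dim_UNIV)
  have fin: "finite S" "finite T" "finite J"
    using independent_imp_finite[OF S(4)] independent_imp_finite[OF T(4)] finite_subset[OF J(1)] by auto
  have "card (Basis - J) = card T"
    using J T dimW fin by (simp add: card_Diff_subset)
  then obtain h where h: "bij_betw h (Basis - J) T"
    using fin finite_same_card_bij by (metis finite_Basis finite_Diff)
  obtain g where g: "bij_betw g J S"
    using fin J S finite_same_card_bij by metis
  define e where "e b = (if b \<in> J then g b else h b)" for b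
  have e: "e b \<in> S" if "b \<in> J" for b
    using that g by (auto simp: e_def bij_betw_def)
  have e': "e b \<in> T" if "b \<in> Basis" "b \<notin> J" for b
    using that h by (auto simp: e_def bij_betw_def)
  have ST: "x \<bullet> y = 0" if "x \<in> S" "y \<in> T" for x y
    using that S T by (auto simp: orthogonal_def)
  have orth: "e a \<bullet> e b = (if a = b then 1 else 0)" if ab: "a \<in> Basis" "b \<in> Basis" for a b
  proof (cases "a = b")
    case True
    have "norm (e b) = 1"
      using e[of b] e'[of b] S T ab by (cases "b \<in> J") auto
    with True show ?thesis by (simp add: norm_eq_1)
  next
    case False
    show ?thesis
    proof (cases "a \<in> J"; cases "b \<in> J")
      assume "a \<in> J" "b \<in> J"
      then have "e a \<noteq> e b" "e a \<in> S" "e b \<in> S"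
        using False g by (auto simp: e_def bij_betw_def inj_on_def)
      then show ?thesis
        using S(2) False by (auto simp: pairwise_def orthogonal_def)
    next
      assume "a \<notin> J" "b \<notin> J"
      then have "e a \<noteq> e b" "e a \<in> T" "e b \<in> T"
        using False h ab by (auto simp: e_def bij_betw_def inj_on_def)
      then show ?thesis
        using T(2) False by (auto simp: pairwise_def orthogonal_def)
    next
      assume "a \<in> J" "b \<notin> J"
      then show ?thesis
        using False ab ST[OF e e'] by simp
    next
      assume "a \<notin> J" "b \<in> J"
      then show ?thesis
        using False ab ST[OF e e', of b a] by (simp add: inner_commute)
    qed
  qed
  define f where "f x = (\<Sum>b\<in>Basis. (x \<bullet> b) *\<^sub>R e b)" for x
  have "f x \<bullet> f y = x \<bullet> y" for x y
  proof -
    have "f x \<bullet> f y = (\<Sum>b\<in>Basis. \<Sum>a\<in>Basis. (x \<bullet> a) * (y \<bullet> b) * (e a \<bullet> e b))"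
      by (simp add: f_def inner_sum_left inner_sum_right sum_distrib_left mult_ac)
    also have "\<dots> = (\<Sum>b\<in>Basis. \<Sum>a\<in>Basis. if a = b then (x \<bullet> b) * (y \<bullet> b) else 0)"
      by (intro sum.cong refl) (auto simp: orth)
    also have "\<dots> = x \<bullet> y"
      by (subst euclidean_inner[of x y]) simp
    finally show ?thesis .
  qed
  moreover have "linear f"
    unfolding f_def by (intro linearI) (simp_all add: inner_add_left scaleR_add_left sum.distrib scaleR_sum_right)
  moreover have "f b = e b" if "b \<in> Basis" for b
    using that by (simp add: f_def inner_Basis if_distrib if_distribR cong: if_cong)
  then have "f ` J \<subseteq> V"
    using e S(1) J(1) by (auto simp: subset_eq)
  ultimately show thesis
    by (intro that[of f]) (simp_all add: orthogonal_transformation_def)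
qed

section \<open>Capturing a direction\<close>

text \<open>The tolerance is relative to \<open>norm z\<close>, which makes the notion invariant
  under nonzero scaling of \<open>z\<close>. The zero vector is never captured.\<close>

definition captures :: "real \<Rightarrow> real ^ 'd ^ 'n \<Rightarrow> real ^ 'n \<Rightarrow> bool" where
  "captures r B z \<longleftrightarrow> (\<exists>y. norm (B *v y - z) < r * norm z)"

lemma continuous_on_matrix_vector_mult_left:
  "continuous_on S (\<lambda>B :: real ^ 'd ^ 'n. B *v y)"
  by (intro linear_continuous_on linear_conv_bounded_linear[THEN iffD1] linearI)
    (simp_all add: matrix_vector_mult_add_rdistrib scaleR_matrix_vector_assoc)

text \<open>A union over all \<open>y\<close> of open sets. Openness in the pair provides the joint
  measurability needed to exchange the integrals.\<close>

lemma open_captures: "open {(B, z). captures r (B :: real ^ 'd ^ 'n) z}"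
proof -
  have "{(B, z). captures r (B :: real ^ 'd ^ 'n) z} = (\<Union>y. {p. norm (fst p *v y - snd p) < r * norm (snd p)})"
    by (auto simp: captures_def)
  moreover have "continuous_on UNIV (\<lambda>p :: (real ^ 'd ^ 'n) \<times> (real ^ 'n). fst p *v y)" for y
    by (rule continuous_on_compose2[OF continuous_on_matrix_vector_mult_left continuous_on_fst[OF continuous_on_id]])
      (rule subset_UNIV)
  ultimately show ?thesis
    by (auto intro!: open_UN open_Collect_less continuous_intros)
qed

lemma captures_borel [measurable]:
  "Measurable.pred (borel \<Otimes>\<^sub>M borel) (\<lambda>(B, z). captures r (B :: real ^ 'd ^ 'n) z)"
  unfolding borel_prod using borel_open[OF open_captures[of r]] by (simp add: pred_def split_beta')

lemma captures_orthogonal: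
  assumes "orthogonal_transformation f"
  shows "captures r (matrix f ** B) (f z) \<longleftrightarrow> captures r B z"
proof -
  have lin: "linear f" using assms by (rule orthogonal_transformation_linear)
  have "(matrix f ** B) *v y - f z = f (B *v y - z)" for y
    using fun_cong[OF matrix_vector_mul(2)[OF lin], of "B *v y"] lin
    by (simp add: matrix_vector_mul_assoc[symmetric] linear_diff)
  then show ?thesis
    by (simp add: captures_def orthogonal_transformation_norm[OF assms])
qed

lemma captures_scale:
  assumes "c \<noteq> 0" "captures r B z"
  shows "captures r B (c *\<^sub>R z)"
proof -
  obtain y where y: "norm (B *v y - z) < r * norm z"
    using assms by (auto simp: captures_def)
  have "B *v (c *\<^sub>R y) - c *\<^sub>R z = c *\<^sub>R (B *v y - z)"
    by (simp add: matrix_vector_mult_scaleR scaleR_diff_right)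
  moreover have "norm (c *\<^sub>R (B *v y - z)) < r * norm (c *\<^sub>R z)"
    unfolding norm_scaleR using mult_strict_left_mono[OF y, of "\<bar>c\<bar>"] assms by (simp add: mult_ac)
  ultimately have "norm (B *v (c *\<^sub>R y) - c *\<^sub>R z) < r * norm (c *\<^sub>R z)"
    by simp
  then show ?thesis
    unfolding captures_def by blast
qed

lemma captures_scale_iff:
  assumes "c \<noteq> 0"
  shows "captures r B (c *\<^sub>R z) \<longleftrightarrow> captures r B z"
  using captures_scale[OF assms] captures_scale[of "inverse c" r B "c *\<^sub>R z"] assms by auto

text \<open>Scale \<open>z\<close> to the length of \<open>z'\<close>, then rotate one onto the
  other; the rotation is absorbed by the matrix, whose law is invariant.\<close>

lemma emeasure_captures_eq:
  fixes z z' :: "real ^ 'n"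
  assumes "z \<noteq> 0" "z' \<noteq> 0"
  shows "emeasure std_gaussian {B :: real ^ 'd ^ 'n. captures r B z} =
    emeasure std_gaussian {B :: real ^ 'd ^ 'n. captures r B z'}"
proof -
  define c where "c = norm z' / norm z"
  have c: "c \<noteq> 0" "norm (c *\<^sub>R z) = norm z'"
    using assms by (auto simp: c_def)
  obtain f where f: "orthogonal_transformation f" "f z' = c *\<^sub>R z"
    using orthogonal_transformation_exists[OF c(2)[symmetric]] by blast
  let ?F = "\<lambda>B :: real ^ 'd ^ 'n. matrix f ** B"
  have F: "orthogonal_transformation ?F"
    using f by (intro orthogonal_transformation_matrix_mult)
  have [measurable]: "?F \<in> borel_measurable borel"
    by (intro borel_measurable_linear_euclidean orthogonal_transformation_linear F)
  have "emeasure std_gaussian {B :: real ^ 'd ^ 'n. captures r B z} =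
      emeasure (distr std_gaussian borel ?F) {B. captures r B (c *\<^sub>R z)}"
    using c by (simp add: captures_scale_iff std_gaussian_distr_orthogonal[OF F])
  also have "\<dots> = emeasure std_gaussian {B :: real ^ 'd ^ 'n. captures r B z'}"
    by (subst emeasure_distr) (auto simp: vimage_def f(2)[symmetric] captures_orthogonal[OF f(1)])
  finally show ?thesis .
qed

text \<open>An orthogonal \<open>f\<close> carries a coordinate subspace of dimension
  \<open>d\<close> into the range of \<open>B\<close>. As \<open>f x\<close> is again Gaussian, it
  suffices that \<open>f x\<close> is captured whenever \<open>x\<close> lies in the coordinate
  cone.\<close>

lemma emeasure_captured_ge_tau:
  fixes B :: "real ^ 'd ^ 'n"
  assumes r: "0 < r" "r < 1" and dn: "CARD('d) < CARD('n)" and B: "inj ((*v) B)"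
  shows "ennreal (tau r CARD('d) CARD('n)) \<le> emeasure std_gaussian {z. captures r B z}"
proof -
  let ?V = "range ((*v) B)"
  have V: "subspace ?V"
    by (intro linear_subspace_image) auto
  have dimV: "dim ?V = CARD('d)"
    using dim_image_eq[of "(*v) B" UNIV] B by (simp add: inj_on_def)
  obtain J :: "(real ^ 'n) set" where J: "J \<subseteq> Basis" "card J = CARD('d)"
    using obtain_subset_with_card_n[of "CARD('d)" "Basis :: (real ^ 'n) set"] dn by auto
  obtain f where f: "orthogonal_transformation f" "f ` J \<subseteq> ?V"
    using orthogonal_transformation_onto_subspace[OF V J(1)] J dimV by metis
  have lin: "linear f" using f by (intro orthogonal_transformation_linear)
  have [measurable]: "f \<in> borel_measurable borel"
    using lin by (rule borel_measurable_linear_euclidean)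
  define I where "I = Basis - J"
  have finJ: "finite J" using finite_subset[OF J(1)] by simp
  have card_I: "card I = CARD('n) - CARD('d)"
    using J finJ by (simp add: I_def card_Diff_subset)
  moreover have "CARD('n) - CARD('d) \<noteq> CARD('n)" "CARD('n) - CARD('d) \<noteq> 0"
    using dn zero_less_card_finite[where 'a='d] by linarith+
  ultimately have "card I \<noteq> 0" "card I \<noteq> card (Basis :: (real ^ 'n) set)"
    by simp_all
  then have I: "I \<subseteq> Basis" "I \<noteq> {}" "I \<noteq> Basis" "card I = CARD('n) - CARD('d)"
    using card_I by (auto simp: I_def)
  define m where "m = CARD('n) - CARD('d)"
  have m: "m > 0" "CARD('n) = m + CARD('d)" "card I = m"
    using dn I by (auto simp: m_def)
  have cone: "captures r B (f x)" if "(\<Sum>b\<in>I. (x \<bullet> b)\<^sup>2) < r\<^sup>2 * (norm x)\<^sup>2" for x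
  proof -
    \<comment> \<open>\<open>w\<close> is the projection of \<open>x\<close> onto the span of
      \<open>J\<close>. Its image under \<open>f\<close> lies in the range of \<open>B\<close> and
      supplies the witness \<open>y\<close>.\<close>
    define w where "w = (\<Sum>b\<in>J. (x \<bullet> b) *\<^sub>R b)"
    have "f w = (\<Sum>b\<in>J. (x \<bullet> b) *\<^sub>R f b)"
      by (simp add: w_def linear_sum[OF lin] linear_scale[OF lin])
    also have "\<dots> \<in> ?V"
      using f V by (intro subspace_sum subspace_scale) auto
    finally obtain y where y: "f w = B *v y" by auto
    have "x - w = (\<Sum>b\<in>I. (x \<bullet> b) *\<^sub>R b)"
      using euclidean_representation[of x] sum.subset_diff[OF J(1), of "\<lambda>b. (x \<bullet> b) *\<^sub>R b"]
      by (simp add: w_def I_def diff_eq_eq)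
    moreover have "(\<Sum>b\<in>I. (x \<bullet> b) *\<^sub>R b) \<bullet> (\<Sum>b\<in>I. (x \<bullet> b) *\<^sub>R b) = (\<Sum>b\<in>I. (x \<bullet> b)\<^sup>2)"
    proof -
      have fin: "finite I" using finite_subset[OF I(1)] by simp
      have "(\<Sum>b\<in>I. (x \<bullet> b) *\<^sub>R b) \<bullet> (\<Sum>b\<in>I. (x \<bullet> b) *\<^sub>R b) =
          (\<Sum>b\<in>I. \<Sum>a\<in>I. if a = b then (x \<bullet> b)\<^sup>2 else 0)"
        unfolding inner_sum_left inner_sum_right using I(1)
        by (intro sum.cong refl) (auto simp: inner_Basis power2_eq_square subset_eq)
      with fin show ?thesis by simp
    qed
    ultimately have "(norm (x - w))\<^sup>2 = (\<Sum>b\<in>I. (x \<bullet> b)\<^sup>2)"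
      by (simp add: power2_norm_eq_inner)
    then have "(norm (x - w))\<^sup>2 < (r * norm x)\<^sup>2"
      using that by (simp add: power_mult_distrib)
    then have "norm (x - w) < r * norm x"
      using r by (intro power2_less_imp_less[of "norm (x - w)"]) auto
    moreover have "norm (B *v y - f x) = norm (x - w)"
      using orthogonal_transformation_norm[OF f(1), of "w - x"]
      by (simp add: y[symmetric] linear_diff[OF lin] norm_minus_commute)
    ultimately show ?thesis
      unfolding captures_def orthogonal_transformation_norm[OF f(1)] by (intro exI[of _ y]) simp
  qed
  have "ennreal (tau r CARD('d) CARD('n)) \<le>
      emeasure std_gaussian {x::real ^ 'n. (\<Sum>b\<in>I. (x \<bullet> b)\<^sup>2) < r\<^sup>2 * (norm x)\<^sup>2}"
    using tau_le_cone[OF r m(1), of "CARD('d)"] m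
    by (subst emeasure_std_gaussian_cone[OF I(1-3) r]) (simp_all add: zero_less_card_finite)
  also have "\<dots> \<le> emeasure std_gaussian {x. captures r B (f x)}"
    using cone by (intro emeasure_mono) auto
  also have "\<dots> = emeasure (distr std_gaussian borel f) {z. captures r B z}"
    by (subst emeasure_distr) (auto simp: vimage_def)
  also have "\<dots> = emeasure std_gaussian {z. captures r B z}"
    by (simp add: std_gaussian_distr_orthogonal[OF f(1)])
  finally show ?thesis .
qed

text \<open>
  The probability that a fixed direction \<open>z\<close> is captured by a Gaussian matrix does not depend on
  \<open>z\<close>, so \<open>z\<close> may be taken Gaussian as well; then the matrix can be frozen instead.
\<close>

lemma emeasure_captures_ge_tau:
  fixes z :: "real ^ 'n"
  assumes r: "0 < r" "r < 1" and dn: "CARD('d) < CARD('n)" and z: "z \<noteq> 0"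
  shows "ennreal (tau r CARD('d) CARD('n)) \<le> emeasure std_gaussian {B :: real ^ 'd ^ 'n. captures r B z}"
proof -
  let ?\<mu> = "std_gaussian :: (real ^ 'd ^ 'n) measure" and ?\<nu> = "std_gaussian :: (real ^ 'n) measure"
  interpret mu: prob_space ?\<mu> by (rule prob_space_std_gaussian)
  interpret nu: prob_space ?\<nu> by (rule prob_space_std_gaussian)
  interpret pair_sigma_finite ?\<mu> ?\<nu> ..
  have section_right: "emeasure ?\<nu> {x. captures r B x} =
      (\<integral>\<^sup>+x. indicator {p. captures r (fst p) (snd p)} (B, x) \<partial>?\<nu>)" for B :: "real ^ 'd ^ 'n"
  proof -
    have "emeasure ?\<nu> {x. captures r B x} = (\<integral>\<^sup>+x. indicator {x. captures r B x} x \<partial>?\<nu>)"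
      by (rule nn_integral_indicator[symmetric]) measurable
    then show ?thesis by (simp add: indicator_def)
  qed
  have section_left: "emeasure ?\<mu> {B. captures r B x} =
      (\<integral>\<^sup>+B. indicator {p. captures r (fst p) (snd p)} (B, x) \<partial>?\<mu>)" for x
  proof -
    have "emeasure ?\<mu> {B. captures r B x} = (\<integral>\<^sup>+B. indicator {B. captures r B x} B \<partial>?\<mu>)"
      by (rule nn_integral_indicator[symmetric]) measurable
    then show ?thesis by (simp add: indicator_def)
  qed
  have "ennreal (tau r CARD('d) CARD('n)) = (\<integral>\<^sup>+B. ennreal (tau r CARD('d) CARD('n)) \<partial>?\<mu>)"
    using mu.emeasure_space_1 by simp
  also have "\<dots> \<le> (\<integral>\<^sup>+B. emeasure ?\<nu> {z. captures r B z} \<partial>?\<mu>)"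
    using AE_std_gaussian_injective[OF dn]
    by (intro nn_integral_mono_AE) (auto elim!: eventually_mono intro: emeasure_captured_ge_tau[OF r dn])
  also have "\<dots> = (\<integral>\<^sup>+B. \<integral>\<^sup>+x. indicator {p. captures r (fst p) (snd p)} (B, x) \<partial>?\<nu> \<partial>?\<mu>)"
    by (simp only: section_right)
  also have "\<dots> = (\<integral>\<^sup>+x. \<integral>\<^sup>+B. indicator {p. captures r (fst p) (snd p)} (B, x) \<partial>?\<mu> \<partial>?\<nu>)"
    by (rule Fubini'[symmetric]) measurable
  also have "\<dots> = (\<integral>\<^sup>+x. emeasure ?\<mu> {B. captures r B x} \<partial>?\<nu>)"
    by (simp only: section_left)
  also have "\<dots> = (\<integral>\<^sup>+x. emeasure ?\<mu> {B. captures r B z} \<partial>?\<nu>)"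
  \<comment> \<open>Independence of the direction holds only away from 0, which is a null set for
    the Gaussian law.\<close>
  proof (rule nn_integral_cong_AE)
    have "{0} \<in> null_sets ?\<nu>"
      by (intro std_gaussian_null) auto
    then have "AE x in ?\<nu>. x \<noteq> 0"
      using AE_not_in by fastforce
    then show "AE x in ?\<nu>. emeasure ?\<mu> {B. captures r B x} = emeasure ?\<mu> {B. captures r B z}"
      by eventually_elim (rule emeasure_captures_eq[OF _ z])
  qed
  also have "\<dots> = emeasure ?\<mu> {B. captures r B z}"
    using nu.emeasure_space_1 by simp
  finally show ?thesis .
qed

theorem theorem4p3:
  fixes M :: "'w measure"
    and A :: "'w \<Rightarrow> real ^ 'd ^ 'n"
    and X :: "(real ^ 'n) set"
    and f :: "real ^ 'n \<Rightarrow> real"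
    and L \<epsilon> :: real
    and x_star p :: "real ^ 'n"
  assumes "prob_space M"
    and "CARD('d) < CARD('n)"
    and "interior X \<noteq> {}"
    and "L > 0"
    and "L-lipschitz_on X f"
    and "gaussian_matrix M A"
    and "\<epsilon> > 0"
    and "is_arg_min f (\<lambda>x. x \<in> X) x_star"
    and "cball x_star (\<epsilon> / L) \<subseteq> X"
    and "p \<in> X - eps_minimizers f X \<epsilon>"
  shows "prob_at_least M (RPX_success_event M f X \<epsilon> p A)
           (tau (\<epsilon> / (L * norm (x_star - p))) CARD('d) CARD('n))"
proof -
  interpret prob_space M by fact
  note [measurable] = gaussian_matrix_measurable[OF \<open>gaussian_matrix M A\<close>]
  define z where "z = x_star - p"
  define r where "r = \<epsilon> / (L * norm z)"
  have x_star: "x_star \<in> X" and min: "\<And>x. x \<in> X \<Longrightarrow> f x_star \<le> f x"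
    using \<open>is_arg_min f (\<lambda>x. x \<in> X) x_star\<close> by (auto simp: is_arg_min_def not_less)
  have opt: "opt_value f X = f x_star"
    unfolding opt_value_def using x_star min by (intro cInf_eq_minimum) auto
  have p: "p \<in> X" "f p > f x_star + \<epsilon>"
    using \<open>p \<in> X - eps_minimizers f X \<epsilon>\<close> by (auto simp: eps_minimizers_def opt)
  have lip: "\<bar>f x - f y\<bar> \<le> L * norm (x - y)" if "x \<in> X" "y \<in> X" for x y
    using lipschitz_onD[OF \<open>L-lipschitz_on X f\<close> that] by (simp add: dist_norm)
  \<comment> \<open>As \<open>p\<close> is not an \<open>\<epsilon>\<close>-minimizer, the Lipschitz
    bound keeps it farther than \<open>\<epsilon> / L\<close> from \<open>x_star\<close>; hence
    \<open>r < 1\<close> and \<open>z\<close> is nonzero.\<close>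
  have "\<epsilon> < L * norm z"
    using lip[OF x_star p(1)] p(2) by (simp add: z_def)
  then have r: "0 < r" "r < 1" and z: "z \<noteq> 0"
    using \<open>L > 0\<close> \<open>\<epsilon> > 0\<close> by (auto simp: r_def)
  \<comment> \<open>\<open>E\<close> is measurable for every \<open>X\<close>, and so can witness
    the bound on the inner measure of the success event.\<close>
  define E where "E = {\<omega> \<in> space M. captures r (A \<omega>) z}"
  have E: "E \<in> sets M"
    unfolding E_def by measurable
  have success: "E \<subseteq> RPX_success_event M f X \<epsilon> p A"
  proof
    fix \<omega> assume "\<omega> \<in> E"
    then obtain y where \<omega>: "\<omega> \<in> space M" and y: "norm (A \<omega> *v y - z) < r * norm z"
      by (auto simp: E_def captures_def)
    let ?x = "A \<omega> *v y + p"
    \<comment> \<open>Here \<open>r * norm z\<close> is \<open>\<epsilon> / L\<close>, and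
      \<open>?x - x_star\<close> is \<open>A \<omega> *v y - z\<close>.\<close>
    have "norm (x_star - ?x) < \<epsilon> / L"
      using y z by (simp add: r_def z_def norm_minus_commute algebra_simps)
    then have x: "?x \<in> X" "L * norm (?x - x_star) \<le> \<epsilon>"
      using \<open>cball x_star (\<epsilon> / L) \<subseteq> X\<close> \<open>L > 0\<close>
      by (auto simp: subset_eq dist_norm field_simps norm_minus_commute)
    then have "f ?x \<le> f x_star + \<epsilon>"
      using lip[OF x(1) x_star] by simp
    with x \<omega> show "\<omega> \<in> RPX_success_event M f X \<epsilon> p A"
      by (auto simp: RPX_success_event_def RPX_successful_def opt)
  qed
  have "ennreal (tau r CARD('d) CARD('n)) \<le> emeasure (distr M borel A) {B. captures r B z}"
    using emeasure_captures_ge_tau[OF r \<open>CARD('d) < CARD('n)\<close> z]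
    by (simp add: gaussian_matrix_distr[OF \<open>prob_space M\<close> \<open>gaussian_matrix M A\<close>])
  also have "\<dots> = emeasure M E"
    by (subst emeasure_distr) (auto simp: E_def vimage_def intro!: arg_cong[where f = "emeasure M"])
  finally have tau: "tau r CARD('d) CARD('n) \<le> measure M E"
    by (simp add: emeasure_eq_measure)
  then have "prob_at_least M (RPX_success_event M f X \<epsilon> p A) (tau r CARD('d) CARD('n))"
    unfolding prob_at_least_def using E success by (meson finite_measure_mono order.trans)
  then show ?thesis
    by (simp add: r_def z_def)
qed

end
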